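(* Let $p,q\in\{1,\infty\}$, let $\psi$ and $p$ satisfy the integrability condition (I) given in the context, and let $\boldsymbol\gamma=(\gamma_{\mathfrak u})_{\mathfrak u\subseteq[1:d]}$ be a family of non-negative weights, not all zero, such that $\gamma_{\mathfrak w}>0$ implies $\gamma_{\mathfrak u}>0$ for all $\mathfrak u\subseteq\mathfrak w$. Then the embedding $\imath_{p,q,\psi,\boldsymbol\gamma}:W_{A,p,q,\psi,\boldsymbol\gamma}\hookrightarrow W_{\pitchfork,p,q,\psi,\boldsymbol\gamma}$ and its inverse satisfy $$\|\imath_{p,q,\psi,\boldsymbol\gamma}\|=\|\imath_{p,q,\psi,\boldsymbol\gamma}^{-1}\|=C_{p,q,\psi,\boldsymbol\gamma},$$ where $$C_{p,q,\psi,\boldsymbol\gamma}=\begin{cases}\displaystyle\max_{\mathfrak u\subseteq[1:d]}\sum_{\mathfrak v\subseteq\mathfrak u^c}m_\psi^{|\mathfrak v|}\,\frac{\gamma_{\mathfrak u\cup\mathfrak v}}{\gamma_{\mathfrak u}} & \text{for } p=\infty,\ q=\infty,\\[2ex] \displaystyle\max_{\mathfrak v\subseteq[1:d]}\sum_{\mathfrak u\subseteq\mathfrak v}m_\psi^{|\mathfrak v|-|\mathfrak u|}\,\frac{\gamma_{\mathfrak v}}{\gamma_{\mathfrak u}} & \text{for } p=\infty,\ q=1,\\[2ex] \displaystyle\max_{\mathfrak v\subseteq[1:d]}\sum_{\mathfrak u\subseteq\mathfrak v}\kappa_\psi^{|\mathfrak v|-|\mathfrak u|}\,\frac{\gamma_{\mathfrak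 v}}{\gamma_{\mathfrak u}} & \text{for } p=1,\ q=1,\\[2ex] \displaystyle\max_{\mathfrak u\subseteq[1:d]}\sum_{\mathfrak v\subseteq\mathfrak u^c}\kappa_\psi^{|\mathfrak v|}\,\frac{\gamma_{\mathfrak u\cup\mathfrak v}}{\gamma_{\mathfrak u}} & \text{for } p=1,\ q=\infty,\end{cases}$$ with the convention $\frac00=0$.
   Context: Setting. $D$ is an interval, either $D=[0,T)$ with $T\in(0,\infty]$ or $D=[0,T]$ with $T\in(0,\infty)$; $\psi:D\to[0,\infty)$ is a probability density function (with respect to Lebesgue measure) that is positive almost everywhere. $d$ is a positive integer, $[1:d]=\{1,\dots,d\}$, and $\mathfrak u,\mathfrak v,\mathfrak w$ denote subsets of $[1:d]$; $\mathfrak u^c=[1:d]\setminus\mathfrak u$. For $\mathfrak u\neq\emptyset$, $D^{\mathfrak u}$ is the set of points $\boldsymbol x_{\mathfrak u}=(x_j)_{j\in\mathfrak u}$ with $x_j\in D$; functions on $D^{\mathfrak u}$ are identified with functions on $D^d$ depending only on the variables with indices in $\mathfrak u$. For $1\le p\le\infty$, $p'$ is the conjugate index, $1/p+1/p'=1$. $L_{p,\psi}(D^{\mathfrak u})$ is the Banach space of (classes of) real-valued functions with norm $\|g\|_{L_{p,\psi}(D^{\mathfrak u})}=\left(\int_{D^{\mathfrak u}}|g(\boldsymbol t_{\mathfrak u})|^p\prod_{j\in\mathfrak u}\psi(t_j)\,d\boldsymbol t_{\mathfrak u}\right)^{1/p}$ for $p<\infty$ and the essential supremum norm for $p=\infty$.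 $L_p^{\mathrm{loc}}(D)$ is the set of functions on $D$ whose restriction to $[0,x)$ is in $L_p([0,x))$ for all $x\in D$. Put $\overline\psi(t)=\int_t^T\psi(y)\,dy$. Integrability condition (I) for $p$ and $\psi$: either $p=\infty$ and $\overline\psi\in L_1(D)$; or $p<\infty$, $\psi^{-1/p}\in L_{p'}^{\mathrm{loc}}(D)$ and $\overline\psi\cdot\psi^{-1/p}\in L_{p'}(D)$. Under (I) one has $m_\psi:=\int_D\overline\psi(t)\,dt=\int_D y\,\psi(y)\,dy\in(0,\infty)$, and for $p=1$ also $\kappa_\psi:=\|\overline\psi/\psi\|_{L_\infty(D)}\in(0,\infty)$. Kernels: $K_\pitchfork(x,t)=1_{[0,x)}(t)$, $K_A(x,t)=1_{[0,x)}(t)-\overline\psi(t)$ for $x,t\in D$, and $K_{\star,\mathfrak u}(\boldsymbol x_{\mathfrak u},\boldsymbol t_{\mathfrak u})=\prod_{j\in\mathfrak u}K_\star(x_j,t_j)$ for $\star\in\{\pitchfork,A\}$. For $\mathfrak u\ne\emptyset$ and $g_{\mathfrak u}\in L_{p,\psi}(D^{\mathfrak u})$ put $T_{\star,\mathfrak u}(g_{\mathfrak u})=\int_{D^{\mathfrak u}}g_{\mathfrak u}(\boldsymbol t_{\mathfrak u})K_{\star,\mathfrak u}(\cdot_{\mathfrak u},\boldsymbol t_{\mathfrak u})\,d\boldsymbol t_{\mathfrak u}$. For $\mathfrak u=\emptyset$, $L_{p,\psi}(D^\emptyset)=\mathbb R$ with norm $|\cdot|$ and $T_{\star,\emptyset}(c)$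 is the constant function $c$. Let $F_{\star,p,\psi,\mathfrak u}=T_{\star,\mathfrak u}(L_{p,\psi}(D^{\mathfrak u}))$; the maps $T_{\star,\mathfrak u}$ are one-to-one, and $\|T_{\star,\mathfrak u}(g)\|_{F_{\star,p,\psi,\mathfrak u}}:=\|g\|_{L_{p,\psi}(D^{\mathfrak u})}$. The sum of the spaces $F_{\star,p,\psi,\mathfrak u}$ over $\mathfrak u\subseteq[1:d]$ (inside the continuous functions on $D^d$) is direct. For weights $\boldsymbol\gamma=(\gamma_{\mathfrak u})_{\mathfrak u\subseteq[1:d]}$ let $\mathfrak U_{\boldsymbol\gamma}=\{\mathfrak u\subseteq[1:d]:\gamma_{\mathfrak u}>0\}$, assumed non-empty. For $\star\in\{\pitchfork,A\}$ and $1\le q\le\infty$, $W_{\star,p,q,\psi,\boldsymbol\gamma}=\bigoplus_{\mathfrak u\in\mathfrak U_{\boldsymbol\gamma}}F_{\star,p,\psi,\mathfrak u}$, a space of functions $f=\sum_{\mathfrak u\in\mathfrak U_{\boldsymbol\gamma}}T_{\star,\mathfrak u}(g_{\star,\mathfrak u})$ on $D^d$, with norm $\|f\|_{W_{\star,p,q,\psi,\boldsymbol\gamma}}=\left(\sum_{\mathfrak u\in\mathfrak U_{\boldsymbol\gamma}}(\|g_{\star,\mathfrak u}\|_{L_{p,\psi}(D^{\mathfrak u})}/\gamma_{\mathfrak u})^q\right)^{1/q}$ for $q<\infty$ and the maximum over $\mathfrak u\in\mathfrak U_{\boldsymbol\gamma}$ for $q=\infty$. ($\star=\pitchfork$: anchored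 space; $\star=A$: ANOVA space.) If $\gamma_{\mathfrak w}>0$ implies $\gamma_{\mathfrak u}>0$ for all $\mathfrak u\subseteq\mathfrak w$, the two spaces coincide as vector spaces of functions; $\imath_{p,q,\psi,\boldsymbol\gamma}$ is the identity map from $W_{A,p,q,\psi,\boldsymbol\gamma}$ to $W_{\pitchfork,p,q,\psi,\boldsymbol\gamma}$, and norms of $\imath$ and $\imath^{-1}$ are operator norms. *)

theory Defs
  imports "HOL-Probability.Essential_Supremum"
begin

definition is_domain :: "real set \<Rightarrow> bool" where
  "is_domain D \<longleftrightarrow> D = {0..} \<or> (\<exists>T>0. D = {0..<T} \<or> D = {0..T})"

definition is_pos_density :: "real set \<Rightarrow> (real \<Rightarrow> real) \<Rightarrow> bool" where
  "is_pos_density D \<psi> \<longleftrightarrow> (\<forall>y\<in>D. 0 \<le> \<psi> y) \<and> has_bochner_integral (lebesgue_on D) \<psi> 1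
     \<and> (AE y in lebesgue_on D. 0 < \<psi> y)"

definition conj_index :: "ereal \<Rightarrow> ereal" where
  "conj_index p = (if p = 1 then \<infinity> else if p = \<infinity> then 1 else p / (p - 1))"

definition Lp_space :: "ereal \<Rightarrow> 'a measure \<Rightarrow> ('a \<Rightarrow> real) set" where
  "Lp_space p M = {g \<in> borel_measurable M.
     if p = \<infinity> then esssup M (\<lambda>t. ereal \<bar>g t\<bar>) < \<infinity>
     else integrable M (\<lambda>t. \<bar>g t\<bar> powr real_of_ereal p)}"

definition Lp_norm :: "ereal \<Rightarrow> 'a measure \<Rightarrow> ('a \<Rightarrow> real) \<Rightarrow> real" where
  "Lp_norm p M g = (if p = \<infinity> then real_of_ereal (esssup M (\<lambda>t. ereal \<bar>g t\<bar>))
     else (LINT t|M. \<bar>g t\<bar> powr real_of_ereal p) powr (1 / real_of_ereal p))"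

definition Lp_loc :: "ereal \<Rightarrow> real set \<Rightarrow> (real \<Rightarrow> real) set" where
  "Lp_loc p D = {g. \<forall>x\<in>D. g \<in> Lp_space p (lebesgue_on {0..<x})}"

text \<open>The tail integral of \<open>\<psi>\<close> from \<open>t\<close> to the right endpoint of \<open>D\<close>.\<close>

definition psibar :: "real set \<Rightarrow> (real \<Rightarrow> real) \<Rightarrow> real \<Rightarrow> real" where
  "psibar D \<psi> t = (LINT y|lebesgue_on (D \<inter> {t..}). \<psi> y)"

definition integrability_cond :: "ereal \<Rightarrow> real set \<Rightarrow> (real \<Rightarrow> real) \<Rightarrow> bool" where
  "integrability_cond p D \<psi> \<longleftrightarrow>
     (p = \<infinity> \<and> psibar D \<psi> \<in> Lp_space 1 (lebesgue_on D))
   \<or> (p < \<infinity>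
      \<and> (\<lambda>t. \<psi> t powr (- 1 / real_of_ereal p)) \<in> Lp_loc (conj_index p) D
      \<and> (\<lambda>t. psibar D \<psi> t * \<psi> t powr (- 1 / real_of_ereal p))
          \<in> Lp_space (conj_index p) (lebesgue_on D))"

definition m_psi :: "real set \<Rightarrow> (real \<Rightarrow> real) \<Rightarrow> real" where
  "m_psi D \<psi> = (LINT t|lebesgue_on D. psibar D \<psi> t)"

definition kappa_psi :: "real set \<Rightarrow> (real \<Rightarrow> real) \<Rightarrow> real" where
  "kappa_psi D \<psi> = Lp_norm \<infinity> (lebesgue_on D) (\<lambda>t. psibar D \<psi> t / \<psi> t)"

text \<open>
  Points of \<open>D\<^sup>u\<close> are the extensional functions in \<open>\<Pi>\<^sub>E j\<in>u. D\<close>.  The product sigma-algebra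
  below is not completed.  This changes neither the classes of functions modulo null sets nor
  their norms, since every function measurable for the completion agrees almost everywhere with a
  measurable one.  For \<open>u = {}\<close> the product is a one-point space of mass 1, so functions on it
  are real constants \<open>c\<close>, with norm \<open>\<bar>c\<bar>\<close>, and \<open>T_op\<close> maps them to constant functions.
\<close>

abbreviation leb_prod :: "real set \<Rightarrow> nat set \<Rightarrow> (nat \<Rightarrow> real) measure" where
  "leb_prod D u \<equiv> PiM u (\<lambda>_. lebesgue_on D)"

definition weighted_prod :: "real set \<Rightarrow> (real \<Rightarrow> real) \<Rightarrow> nat set \<Rightarrow> (nat \<Rightarrow> real) measure" where
  "weighted_prod D \<psi> u = density (leb_prod D u) (\<lambda>t. ennreal (\<Prod>j\<in>u. \<psi> (t j)))"

datatype space_kind = Anchored | ANOVA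

fun kernel :: "space_kind \<Rightarrow> real set \<Rightarrow> (real \<Rightarrow> real) \<Rightarrow> real \<Rightarrow> real \<Rightarrow> real" where
  "kernel Anchored D \<psi> x t = indicator {0..<x} t"
| "kernel ANOVA D \<psi> x t = indicator {0..<x} t - psibar D \<psi> t"

text \<open>Functions on \<open>D\<^sup>d\<close> are extensional, so that equality in HOL is equality on \<open>D\<^sup>d\<close>.\<close>

definition T_op :: "space_kind \<Rightarrow> nat \<Rightarrow> real set \<Rightarrow> (real \<Rightarrow> real) \<Rightarrow> nat set
    \<Rightarrow> ((nat \<Rightarrow> real) \<Rightarrow> real) \<Rightarrow> (nat \<Rightarrow> real) \<Rightarrow> real" where
  "T_op k d D \<psi> u g = (\<lambda>x \<in> (\<Pi>\<^sub>E j\<in>{1..d}. D).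
     LINT t|leb_prod D u. g t * (\<Prod>j\<in>u. kernel k D \<psi> (x j) (t j)))"

definition supp_weights :: "nat \<Rightarrow> (nat set \<Rightarrow> real) \<Rightarrow> nat set set" where
  "supp_weights d \<gamma> = {u. u \<subseteq> {1..d} \<and> 0 < \<gamma> u}"

definition represents :: "space_kind \<Rightarrow> nat \<Rightarrow> real set \<Rightarrow> (real \<Rightarrow> real) \<Rightarrow> ereal
    \<Rightarrow> (nat set \<Rightarrow> real) \<Rightarrow> (nat set \<Rightarrow> (nat \<Rightarrow> real) \<Rightarrow> real) \<Rightarrow> ((nat \<Rightarrow> real) \<Rightarrow> real) \<Rightarrow> bool" where
  "represents k d D \<psi> p \<gamma> g f \<longleftrightarrow>
     (\<forall>u\<in>supp_weights d \<gamma>. g u \<in> Lp_space p (weighted_prod D \<psi> u))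
   \<and> f = (\<lambda>x \<in> (\<Pi>\<^sub>E j\<in>{1..d}. D). \<Sum>u\<in>supp_weights d \<gamma>. T_op k d D \<psi> u (g u) x)"

definition W_space :: "space_kind \<Rightarrow> nat \<Rightarrow> real set \<Rightarrow> (real \<Rightarrow> real) \<Rightarrow> ereal
    \<Rightarrow> (nat set \<Rightarrow> real) \<Rightarrow> ((nat \<Rightarrow> real) \<Rightarrow> real) set" where
  "W_space k d D \<psi> p \<gamma> = {f. \<exists>g. represents k d D \<psi> p \<gamma> g f}"

definition lq_norm :: "ereal \<Rightarrow> 'i set \<Rightarrow> ('i \<Rightarrow> real) \<Rightarrow> real" where
  "lq_norm q U a = (if q = \<infinity> then Max ((\<lambda>i. \<bar>a i\<bar>) ` U)
     else (\<Sum>i\<in>U. \<bar>a i\<bar> powr real_of_ereal q) powr (1 / real_of_ereal q))"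

text \<open>
  The components \<open>g\<close> of \<open>f\<close> are determined by \<open>f\<close> up to null sets (the operators are injective and
  the sum of their ranges is direct), hence the number below is unique for \<open>f\<close> in \<open>W_space\<close>.
\<close>

definition W_norm :: "space_kind \<Rightarrow> nat \<Rightarrow> real set \<Rightarrow> (real \<Rightarrow> real) \<Rightarrow> ereal \<Rightarrow> ereal
    \<Rightarrow> (nat set \<Rightarrow> real) \<Rightarrow> ((nat \<Rightarrow> real) \<Rightarrow> real) \<Rightarrow> real" where
  "W_norm k d D \<psi> p q \<gamma> f = (THE r. \<exists>g. represents k d D \<psi> p \<gamma> g f
     \<and> r = lq_norm q (supp_weights d \<gamma>) (\<lambda>u. Lp_norm p (weighted_prod D \<psi> u) (g u) / \<gamma> u))"

text \<open>Operator norm of a linear map on the space \<open>V\<close> normed by \<open>N\<close>, into a space normed by \<open>N'\<close>;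
  the value \<open>\<infinity>\<close> means that the map is unbounded.\<close>

definition op_norm :: "'a set \<Rightarrow> ('a \<Rightarrow> real) \<Rightarrow> ('b \<Rightarrow> real) \<Rightarrow> ('a \<Rightarrow> 'b) \<Rightarrow> ereal" where
  "op_norm V N N' \<phi> = (SUP f\<in>{f \<in> V. N f \<le> 1}. ereal (N' (\<phi> f)))"

definition iota :: "nat \<Rightarrow> real set \<Rightarrow> (real \<Rightarrow> real) \<Rightarrow> ereal \<Rightarrow> (nat set \<Rightarrow> real)
    \<Rightarrow> ((nat \<Rightarrow> real) \<Rightarrow> real) \<Rightarrow> (nat \<Rightarrow> real) \<Rightarrow> real" where
  "iota d D \<psi> p \<gamma> = (\<lambda>f \<in> W_space ANOVA d D \<psi> p \<gamma>. f)"

text \<open>Only used for \<open>p, q \<in> {1, \<infinity>}\<close>.  The convention \<open>0 / 0 = 0\<close> is that of HOL.\<close>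

definition C_const :: "nat \<Rightarrow> real set \<Rightarrow> (real \<Rightarrow> real) \<Rightarrow> ereal \<Rightarrow> ereal
    \<Rightarrow> (nat set \<Rightarrow> real) \<Rightarrow> real" where
  "C_const d D \<psi> p q \<gamma> =
    (if p = \<infinity> \<and> q = \<infinity> then
       MAX u\<in>Pow {1..d}. \<Sum>v\<in>Pow ({1..d} - u). m_psi D \<psi> ^ card v * (\<gamma> (u \<union> v) / \<gamma> u)
     else if p = \<infinity> \<and> q = 1 then
       MAX v\<in>Pow {1..d}. \<Sum>u\<in>Pow v. m_psi D \<psi> ^ (card v - card u) * (\<gamma> v / \<gamma> u)
     else if p = 1 \<and> q = 1 then
       MAX v\<in>Pow {1..d}. \<Sum>u\<in>Pow v. kappa_psi D \<psi> ^ (card v - card u) * (\<gamma> v / \<gamma> u)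
     else
       MAX u\<in>Pow {1..d}. \<Sum>v\<in>Pow ({1..d} - u). kappa_psi D \<psi> ^ card v * (\<gamma> (u \<union> v) / \<gamma> u))"

end

theory Submission
  imports Defs
begin

text \<open>
  Write \<open>b\<close> for the tail integral of \<open>\<psi>\<close>.  Each kernel is the other one plus \<open>b\<close> or minus \<open>b\<close>,
  so expanding the product of kernels over \<open>w\<close> and applying Fubini shows that both the embedding and
  its inverse send the components \<open>g\<close> to
  \<open>\<Sum>w \<supseteq> u. (\<plusminus>1)^card (w - u) * P w u (g w)\<close>, where \<open>P w u\<close> integrates the variables
  in \<open>w - u\<close> against products of \<open>b\<close>.  The norm of \<open>P w u\<close> from \<open>L\<^sub>p\<close> to \<open>L\<^sub>p\<close> is \<open>c^card (w - u)\<close>,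
  where \<open>c\<close> is the norm of the functional \<open>\<phi> \<mapsto> \<integral> \<phi> b\<close> on \<open>L\<^sub>p\<close>, i.e. \<open>m\<close> for \<open>p = \<infinity>\<close> and \<open>\<kappa>\<close> for
  \<open>p = 1\<close>.  Hence the operator norm is at most the largest row sum (\<open>q = \<infinity>\<close>) or column sum (\<open>q = 1\<close>)
  of the matrix with entries \<open>c^card (w - u) * \<gamma> w / \<gamma> u\<close>.  Tensor powers of a single unit vector
  \<open>\<phi> \<ge> 0\<close> with \<open>\<integral> \<phi> b\<close> close to \<open>c\<close> are multiplied by exact powers of \<open>\<integral> \<phi> b\<close>, and the signs can be
  compensated by signs in the components, so the bound is sharp.

  The norms are well defined because anchored components are determined by the function: setting
  variables to \<open>0\<close> isolates each component, and its integrals over all boxes determine it almost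
  everywhere.
\<close>

section \<open>Weighted Lebesgue spaces on products\<close>

lemma AE_False_iff: "(AE t in M. False) \<longleftrightarrow> emeasure M (space M) = 0"
  by (simp add: AE_iff_measurable)

text \<open>\<open>real_of_ereal\<close> sends both infinite values to 0, so the real norm reflects
  the essential supremum only when that is finite. The a.e. bound excludes \<infinity>, and positive
  measure of the space excludes -\<infinity>, the essential supremum over a null space.\<close>

lemma Lp_norm_infinity_le_iff:
  fixes f :: "'a \<Rightarrow> real"
  assumes [measurable]: "f \<in> borel_measurable M" and null: "emeasure M (space M) \<noteq> 0"
    and bdd: "AE t in M. \<bar>f t\<bar> \<le> C\<^sub>0"
  shows "Lp_norm \<infinity> M f \<le> C \<longleftrightarrow> (AE t in M. \<bar>f t\<bar> \<le> C)"
proof -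
  let ?e = "esssup M (\<lambda>t. ereal \<bar>f t\<bar>)"
  have ae: "AE t in M. ereal \<bar>f t\<bar> \<le> ?e"
    by (rule esssup_AE)
  have iff: "?e \<le> ereal C \<longleftrightarrow> (AE t in M. \<bar>f t\<bar> \<le> C)" for C
  proof
    assume le: "?e \<le> ereal C"
    from ae show "AE t in M. \<bar>f t\<bar> \<le> C"
    proof eventually_elim
      case (elim t)
      then have "ereal \<bar>f t\<bar> \<le> ereal C" using le by (rule order_trans)
      then show ?case by simp
    qed
  qed (auto intro!: esssup_I)
  have "?e \<le> ereal C\<^sub>0"
    using iff bdd by simp
  moreover have "0 \<le> ?e"
  proof (rule ccontr)
    assume neg: "\<not> 0 \<le> ?e"
    from ae have "AE t in M. False"
    proof eventually_elim
      case (elim t)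
      then have "0 \<le> ?e" by (meson abs_ge_zero ereal_less_eq(5) order_trans)
      with neg show False by simp
    qed
    then show False
      using null by (simp add: AE_False_iff)
  qed
  ultimately obtain r where "?e = ereal r"
    by (cases ?e) auto
  then show ?thesis
    using iff[of C] by (simp add: Lp_norm_def)
qed

lemma AE_bounded_if_esssup_finite:
  assumes "f \<in> Lp_space \<infinity> M"
  shows "\<exists>C. AE t in M. \<bar>f t\<bar> \<le> C"
proof -
  let ?e = "esssup M (\<lambda>t. ereal \<bar>f t\<bar>)"
  have "?e < \<infinity>"
    using assms by (simp add: Lp_space_def)
  then obtain C where C: "?e \<le> ereal C"
    by (metis ereal_dense2 less_imp_le)
  have "AE t in M. ereal \<bar>f t\<bar> \<le> ?e"
    by (rule esssup_AE)
  then have "AE t in M. \<bar>f t\<bar> \<le> C"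
  proof eventually_elim
    case (elim t)
    then have "ereal \<bar>f t\<bar> \<le> ereal C" using C by (rule order_trans)
    then show ?case by simp
  qed
  then show ?thesis ..
qed

text \<open>\<open>M\<close> stands for Lebesgue measure on \<open>D\<close> and \<open>b\<close>
  for the tail integral of \<psi>. The last two assumptions bound the functional \<phi> \<mapsto>
  \<integral> \<phi> b on the weighted \<open>L\<^sub>p\<close> space: b is integrable for p =
  \<infinity>, and b / \<psi> is essentially bounded above for p = 1.\<close>

locale weighted_measure =
  fixes M :: "'b measure" and \<psi> b :: "'b \<Rightarrow> real" and p :: ereal
  assumes sigma_finite_M: "sigma_finite_measure M"
    and \<psi>_measurable [measurable]: "\<psi> \<in> borel_measurable M"
    and \<psi>_nonneg: "\<And>t. t \<in> space M \<Longrightarrow> 0 \<le> \<psi> t"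
    and \<psi>_pos: "AE t in M. 0 < \<psi> t"
    and \<psi>_density: "has_bochner_integral M \<psi> 1"
    and b_measurable [measurable]: "b \<in> borel_measurable M"
    and b_nonneg: "\<And>t. t \<in> space M \<Longrightarrow> 0 \<le> b t"
    and p_cases: "p = 1 \<or> p = \<infinity>"
    and b_integrable: "p = \<infinity> \<Longrightarrow> integrable M b"
    and b_bounded: "p = 1 \<Longrightarrow> \<exists>C. AE t in M. b t \<le> C * \<psi> t"
begin

sublocale product_sigma_finite "\<lambda>_::nat. M"
  by (rule product_sigma_finite.intro) (rule sigma_finite_M)

abbreviation prod_M :: "nat set \<Rightarrow> (nat \<Rightarrow> 'b) measure" where
  "prod_M u \<equiv> PiM u (\<lambda>_. M)"

abbreviation wt :: "nat set \<Rightarrow> (nat \<Rightarrow> 'b) \<Rightarrow> real" where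
  "wt u t \<equiv> \<Prod>j\<in>u. \<psi> (t j)"

abbreviation prod_W :: "nat set \<Rightarrow> (nat \<Rightarrow> 'b) measure" where
  "prod_W u \<equiv> density (prod_M u) (\<lambda>t. ennreal (wt u t))"

abbreviation L :: "nat set \<Rightarrow> ((nat \<Rightarrow> 'b) \<Rightarrow> real) set" where
  "L u \<equiv> Lp_space p (prod_W u)"

abbreviation N :: "nat set \<Rightarrow> ((nat \<Rightarrow> 'b) \<Rightarrow> real) \<Rightarrow> real" where
  "N u \<equiv> Lp_norm p (prod_W u)"

lemma prod_measurable [measurable]:
  assumes "\<And>j. j \<in> v \<Longrightarrow> a j \<in> borel_measurable M" "v \<subseteq> u"
  shows "(\<lambda>t. \<Prod>j\<in>v. a j (t j) :: real) \<in> borel_measurable (prod_M u)"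
  using assms
  by (intro borel_measurable_prod measurable_compose[OF measurable_component_singleton]) auto

lemma wt_measurable [measurable]: "wt u \<in> borel_measurable (prod_M u)"
  by (intro prod_measurable) auto

lemma wt_nonneg: "t \<in> space (prod_M u) \<Longrightarrow> 0 \<le> wt u t"
  by (intro prod_nonneg \<psi>_nonneg) (auto simp: space_PiM)

lemma prod_b_nonneg: "t \<in> space (prod_M u) \<Longrightarrow> 0 \<le> (\<Prod>j\<in>u. b (t j))"
  by (intro prod_nonneg b_nonneg) (auto simp: space_PiM)

text \<open>A null set \<open>Z\<close> of one coordinate lifts to the box with side
  \<open>Z\<close> at \<open>j\<close> and full sides elsewhere. Its measure has a factor 0, and 0 *
  \<infinity> = 0 for extended nonnegative reals, so infinite measure of \<open>M\<close> does no
  harm.\<close>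

lemma AE_prod_component:
  assumes "finite u" "j \<in> u" "AE s in M. Q s"
  shows "AE t in prod_M u. Q (t j)"
proof -
  from assms(3) obtain Z where Z: "Z \<in> null_sets M" "{s\<in>space M. \<not> Q s} \<subseteq> Z"
    by (auto simp: eventually_ae_filter)
  define A where "A = (\<lambda>i. if i = j then Z else space M)"
  have A_sets: "A i \<in> sets M" for i
    using Z by (auto simp: A_def)
  have "emeasure (prod_M u) (PiE u A) = (\<Prod>i\<in>u. emeasure M (A i))"
    using A_sets assms by (intro emeasure_PiM) auto
  also have "\<dots> = 0"
    using assms Z by (auto simp: A_def intro!: prod_zero)
  finally have "PiE u A \<in> null_sets (prod_M u)"
    using A_sets assms by (intro null_setsI sets_PiM_I_finite) auto
  moreover have "{t\<in>space (prod_M u). \<not> Q (t j)} \<subseteq> PiE u A"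
  proof
    fix t assume "t \<in> {t\<in>space (prod_M u). \<not> Q (t j)}"
    then have t: "t \<in> space (prod_M u)" and nQ: "\<not> Q (t j)" by auto
    have "t i \<in> A i" if "i \<in> u" for i
      using t nQ Z(2) that assms(2) by (cases "i = j") (auto simp: A_def space_PiM PiE_mem)
    with t show "t \<in> PiE u A"
      by (auto simp: space_PiM PiE_iff)
  qed
  ultimately show ?thesis
    by (rule AE_I')
qed

lemma AE_prod_all:
  assumes "finite u" "\<And>j. j \<in> u \<Longrightarrow> AE s in M. Q j s"
  shows "AE t in prod_M u. \<forall>j\<in>u. Q j (t j)"
  using assms by (intro AE_finite_allI AE_prod_component) auto

text \<open>The weight is positive almost everywhere, so passing to the density creates no new null
  sets. Essential bounds can therefore be read off in the unweighted product.\<close>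

lemma AE_prod_W:
  assumes "finite u"
  shows "(AE t in prod_W u. Q t) \<longleftrightarrow> (AE t in prod_M u. Q t)"
proof -
  have "AE t in prod_M u. \<forall>j\<in>u. 0 < \<psi> (t j)"
    using assms \<psi>_pos by (intro AE_prod_all)
  then have "AE t in prod_M u. 0 < wt u t"
    by eventually_elim (auto intro: prod_pos)
  then have "(AE t in prod_M u. 0 < wt u t \<longrightarrow> Q t) \<longleftrightarrow> (AE t in prod_M u. Q t)"
    by (intro iffI; (elim AE_mp)?) (auto elim: eventually_mono)
  then show ?thesis
    by (simp add: AE_density)
qed

lemma \<psi>_integrable: "integrable M \<psi>" and \<psi>_integral: "integral\<^sup>L M \<psi> = 1"
  using \<psi>_density by (auto simp: has_bochner_integral_iff)

lemma M_nonnull: "emeasure M (space M) \<noteq> 0"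
proof
  assume "emeasure M (space M) = 0"
  then have "AE x in M. \<psi> x = 0"
    by (intro AE_I[where N = "space M"]) auto
  then have "integral\<^sup>L M \<psi> = 0"
    by (subst integral_cong_AE[where g = "\<lambda>_. 0"]) auto
  then show False
    using \<psi>_integral by simp
qed

lemma prod_M_nonnull:
  assumes "finite u" shows "emeasure (prod_M u) (space (prod_M u)) \<noteq> 0"
  using assms M_nonnull by (auto simp: space_PiM emeasure_PiM)

text \<open>The weight moves from the measure into the integrand, because \<open>T_op\<close> and
  \<open>P\<close> integrate against the unweighted product.\<close>

lemma L1_iff:
  assumes "finite u"
  shows "g \<in> Lp_space 1 (prod_W u) \<longleftrightarrow> g \<in> borel_measurable (prod_M u) \<and> integrable (prod_M u) (\<lambda>t. g t * wt u t)"
proof -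
  have "integrable (prod_W u) (\<lambda>t. \<bar>g t\<bar>) \<longleftrightarrow> integrable (prod_M u) (\<lambda>t. g t * wt u t)"
    if g [measurable]: "g \<in> borel_measurable (prod_M u)"
  proof -
    have "integrable (prod_W u) (\<lambda>t. \<bar>g t\<bar>) \<longleftrightarrow> integrable (prod_M u) (\<lambda>t. wt u t * \<bar>g t\<bar>)"
      by (intro integrable_real_density) (auto intro!: AE_I2 wt_nonneg)
    also have "\<dots> \<longleftrightarrow> integrable (prod_M u) (\<lambda>t. \<bar>g t * wt u t\<bar>)"
      by (intro Bochner_Integration.integrable_cong refl) (use wt_nonneg in \<open>auto simp: abs_mult\<close>)
    also have "\<dots> \<longleftrightarrow> integrable (prod_M u) (\<lambda>t. g t * wt u t)"
      by (intro integrable_abs_iff) auto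
    finally show ?thesis .
  qed
  then show ?thesis
    using assms by (auto simp: Lp_space_def)
qed

lemma N1_eq:
  assumes "finite u" and [measurable]: "g \<in> borel_measurable (prod_M u)"
  shows "Lp_norm 1 (prod_W u) g = (LINT t|prod_M u. \<bar>g t\<bar> * wt u t)"
proof -
  have "Lp_norm 1 (prod_W u) g = (LINT t|prod_W u. \<bar>g t\<bar>)"
    using assms by (simp add: Lp_norm_def)
  also have "\<dots> = (LINT t|prod_M u. wt u t * \<bar>g t\<bar>)"
    by (intro integral_real_density) (auto intro!: AE_I2 wt_nonneg)
  finally show ?thesis by (simp add: mult.commute)
qed

lemma Linf_iff:
  assumes "finite u"
  shows "g \<in> Lp_space \<infinity> (prod_W u) \<longleftrightarrow> g \<in> borel_measurable (prod_M u) \<and> (\<exists>C. AE t in prod_M u. \<bar>g t\<bar> \<le> C)"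
proof -
  have "esssup (prod_W u) (\<lambda>t. ereal \<bar>g t\<bar>) < \<infinity> \<longleftrightarrow> (\<exists>C. AE t in prod_M u. \<bar>g t\<bar> \<le> C)"
    if g [measurable]: "g \<in> borel_measurable (prod_M u)"
  proof
    assume "esssup (prod_W u) (\<lambda>t. ereal \<bar>g t\<bar>) < \<infinity>"
    then have "g \<in> Lp_space \<infinity> (prod_W u)"
      by (simp add: Lp_space_def)
    then show "\<exists>C. AE t in prod_M u. \<bar>g t\<bar> \<le> C"
      using AE_bounded_if_esssup_finite AE_prod_W[OF assms] by blast
  next
    assume "\<exists>C. AE t in prod_M u. \<bar>g t\<bar> \<le> C"
    then obtain C where "AE t in prod_W u. ereal \<bar>g t\<bar> \<le> ereal C"
      using assms AE_prod_W by auto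
    then have "esssup (prod_W u) (\<lambda>t. ereal \<bar>g t\<bar>) \<le> ereal C"
      by (intro esssup_I) auto
    then show "esssup (prod_W u) (\<lambda>t. ereal \<bar>g t\<bar>) < \<infinity>"
      by (auto simp: less_ereal.simps intro: le_less_trans)
  qed
  then show ?thesis
    using assms by (auto simp: Lp_space_def)
qed

lemma Ninf_le_iff:
  assumes "p = \<infinity>" "finite u" "g \<in> L u"
  shows "N u g \<le> C \<longleftrightarrow> (AE t in prod_M u. \<bar>g t\<bar> \<le> C)"
proof -
  obtain C\<^sub>0 where "g \<in> borel_measurable (prod_M u)" "AE t in prod_M u. \<bar>g t\<bar> \<le> C\<^sub>0"
    using assms Linf_iff by auto
  moreover have "emeasure (prod_W u) (space (prod_W u)) \<noteq> 0"
  proof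
    assume "emeasure (prod_W u) (space (prod_W u)) = 0"
    then have "AE t in prod_W u. False"
      by (simp only: AE_False_iff)
    then have "AE t in prod_M u. False"
      using AE_prod_W[OF assms(2)] by blast
    then show False
      using prod_M_nonnull[OF assms(2)] by (simp add: AE_False_iff)
  qed
  ultimately show ?thesis
    using Lp_norm_infinity_le_iff[of g "prod_W u" C\<^sub>0 C] assms AE_prod_W[OF assms(2)] by simp
qed

lemma Ninf_AE:
  assumes "p = \<infinity>" "finite u" "g \<in> L u"
  shows "AE t in prod_M u. \<bar>g t\<bar> \<le> N u g"
  using Ninf_le_iff[OF assms, of "N u g"] by simp

lemma L_measurable: "g \<in> L u \<Longrightarrow> g \<in> borel_measurable (prod_M u)"
  by (simp add: Lp_space_def)

lemma N_nonneg:
  assumes "finite u" "g \<in> L u" shows "0 \<le> N u g"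
proof (cases "p = 1")
  case True
  then show ?thesis
    using assms L_measurable[OF assms(2)] wt_nonneg by (auto simp: N1_eq intro!: integral_nonneg_AE)
next
  case False
  then have p: "p = \<infinity>" using p_cases by auto
  show ?thesis
  proof (rule ccontr)
    assume neg: "\<not> 0 \<le> N u g"
    have "AE t in prod_M u. False"
      using Ninf_AE[OF p assms]
      by eventually_elim (use neg in auto)
    then show False
      using prod_M_nonnull[OF assms(1)] by (simp add: AE_False_iff)
  qed
qed

lemma N_cong:
  assumes "finite u" "g \<in> L u" "h \<in> borel_measurable (prod_M u)"
    and "AE t in prod_M u. g t = h t"
  shows "h \<in> L u" and "N u h = N u g"
proof -
  note [measurable] = assms(3) L_measurable[OF assms(2)]
  have *: "h \<in> L u \<and> N u h = N u g"
  proof (cases "p = 1")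
    case True
    have "integrable (prod_M u) (\<lambda>t. g t * wt u t) \<longleftrightarrow> integrable (prod_M u) (\<lambda>t. h t * wt u t)"
      by (intro integrable_cong_AE) (use assms(4) in \<open>auto elim: eventually_mono\<close>)
    moreover have "(LINT t|prod_M u. \<bar>g t\<bar> * wt u t) = (LINT t|prod_M u. \<bar>h t\<bar> * wt u t)"
      by (intro integral_cong_AE) (use assms(4) in \<open>auto elim: eventually_mono\<close>)
    ultimately show ?thesis
      using assms True by (simp add: N1_eq L1_iff)
  next
    case False
    then have p: "p = \<infinity>" using p_cases by auto
    have iff: "(AE t in prod_M u. \<bar>g t\<bar> \<le> C) \<longleftrightarrow> (AE t in prod_M u. \<bar>h t\<bar> \<le> C)" for C
    proof
      assume "AE t in prod_M u. \<bar>g t\<bar> \<le> C"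
      with assms(4) show "AE t in prod_M u. \<bar>h t\<bar> \<le> C" by eventually_elim simp
    next
      assume "AE t in prod_M u. \<bar>h t\<bar> \<le> C"
      with assms(4) show "AE t in prod_M u. \<bar>g t\<bar> \<le> C" by eventually_elim simp
    qed
    then have "h \<in> L u"
      using assms p by (simp add: Linf_iff)
    \<comment> \<open>For p = \<infinity> the norm is accessible through its upper bounds; two reals
      with the same upper bounds coincide.\<close>
    moreover have "N u h \<le> C \<longleftrightarrow> N u g \<le> C" for C
      using Ninf_le_iff[OF p] assms \<open>h \<in> L u\<close> iff by simp
    ultimately show ?thesis
      by (metis order.eq_iff)
  qed
  then show "h \<in> L u" "N u h = N u g" by auto
qed

lemma L_add:
  assumes "finite u" "g \<in> L u" "h \<in> L u"
  shows "(\<lambda>t. g t + h t) \<in> L u" and "N u (\<lambda>t. g t + h t) \<le> N u g + N u h"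
proof -
  note [measurable] = L_measurable[OF assms(2)] L_measurable[OF assms(3)]
  have *: "(\<lambda>t. g t + h t) \<in> L u \<and> N u (\<lambda>t. g t + h t) \<le> N u g + N u h"
  proof (cases "p = 1")
    case True
    have ig: "integrable (prod_M u) (\<lambda>t. g t * wt u t)" "integrable (prod_M u) (\<lambda>t. h t * wt u t)"
      using assms True by (auto simp: L1_iff)
    have ia: "integrable (prod_M u) (\<lambda>t. \<bar>f t\<bar> * wt u t)"
      if "integrable (prod_M u) (\<lambda>t. f t * wt u t)" for f
      using integrable_abs[OF that]
      by (rule iffD1[OF Bochner_Integration.integrable_cong, rotated 2])
        (use wt_nonneg in \<open>auto simp: abs_mult\<close>)
    have ih: "integrable (prod_M u) (\<lambda>t. (g t + h t) * wt u t)"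
      using Bochner_Integration.integrable_add[OF ig] by (simp add: distrib_right)
    have "(LINT t|prod_M u. \<bar>g t + h t\<bar> * wt u t)
        \<le> (LINT t|prod_M u. \<bar>g t\<bar> * wt u t + \<bar>h t\<bar> * wt u t)"
      by (intro integral_mono ia ih Bochner_Integration.integrable_add ig)
        (auto simp: distrib_right[symmetric] intro!: mult_right_mono wt_nonneg)
    also have "\<dots> = (LINT t|prod_M u. \<bar>g t\<bar> * wt u t) + (LINT t|prod_M u. \<bar>h t\<bar> * wt u t)"
      by (intro Bochner_Integration.integral_add ia ig)
    finally show ?thesis
      using assms True ih by (simp add: N1_eq L1_iff)
  next
    case False
    then have p: "p = \<infinity>" using p_cases by auto
    have ae: "AE t in prod_M u. \<bar>g t + h t\<bar> \<le> N u g + N u h"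
      using Ninf_AE[OF p assms(1,2)] Ninf_AE[OF p assms(1,3)]
      by eventually_elim linarith
    then have "(\<lambda>t. g t + h t) \<in> L u"
      using p assms(1) by (auto simp: Linf_iff)
    then show ?thesis
      using Ninf_le_iff[OF p assms(1)] ae by blast
  qed
  then show "(\<lambda>t. g t + h t) \<in> L u" "N u (\<lambda>t. g t + h t) \<le> N u g + N u h" by auto
qed

lemma zero_in_L:
  assumes "finite u"
  shows "(\<lambda>_. 0) \<in> L u" and "N u (\<lambda>_. 0) = 0"
proof -
  have *: "(\<lambda>_. 0) \<in> L u"
  proof (cases "p = 1")
    case False
    then have "p = \<infinity>" using p_cases by auto
    then show ?thesis using assms by (auto simp: Linf_iff)
  qed (use assms in \<open>simp add: L1_iff\<close>)
  then show "(\<lambda>_. 0) \<in> L u" .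
  show "N u (\<lambda>_. 0) = 0"
  proof (cases "p = 1")
    case False
    then have "p = \<infinity>" using p_cases by auto
    then show ?thesis
      using assms * N_nonneg[OF assms *] Ninf_le_iff[of u "\<lambda>_. 0" 0] by auto
  qed (use assms in \<open>simp add: N1_eq\<close>)
qed

lemma L_scale:
  assumes "finite u" "g \<in> L u"
  shows "(\<lambda>t. r * g t) \<in> L u" and "N u (\<lambda>t. r * g t) = \<bar>r\<bar> * N u g"
proof -
  have mem: "(\<lambda>t. r * g t) \<in> L u" and le: "N u (\<lambda>t. r * g t) \<le> \<bar>r\<bar> * N u g"
    if "g \<in> L u" for r g
  proof -
    note [measurable] = L_measurable[OF that]
    have *: "(\<lambda>t. r * g t) \<in> L u \<and> N u (\<lambda>t. r * g t) \<le> \<bar>r\<bar> * N u g"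
    proof (cases "p = 1")
      case True
      then show ?thesis
        using assms that by (simp add: N1_eq L1_iff abs_mult mult.assoc)
    next
      case False
      then have p: "p = \<infinity>" using p_cases by auto
      have ae: "AE t in prod_M u. \<bar>r * g t\<bar> \<le> \<bar>r\<bar> * N u g"
        using Ninf_AE[OF p assms(1) that]
        by eventually_elim (auto simp: abs_mult intro: mult_left_mono)
      then have "(\<lambda>t. r * g t) \<in> L u"
        using p assms(1) by (auto simp: Linf_iff)
      then show ?thesis
        using Ninf_le_iff[OF p assms(1)] ae by blast
    qed
    then show "(\<lambda>t. r * g t) \<in> L u" "N u (\<lambda>t. r * g t) \<le> \<bar>r\<bar> * N u g" by auto
  qed
  show 1: "(\<lambda>t. r * g t) \<in> L u" by (rule mem[OF assms(2)])
  show "N u (\<lambda>t. r * g t) = \<bar>r\<bar> * N u g"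
  proof (cases "r = 0")
    case False
    \<comment> \<open>The inequality with factor 1 / r, applied to the scaled function, yields the
      opposite estimate.\<close>
    have "N u g \<le> \<bar>1 / r\<bar> * N u (\<lambda>t. r * g t)"
      using le[OF 1, of "1 / r"] False by simp
    then have "\<bar>r\<bar> * N u g \<le> N u (\<lambda>t. r * g t)"
      using False by (simp add: field_simps)
    then show ?thesis
      using le[OF assms(2), of r] by simp
  qed (use zero_in_L[OF assms(1)] in simp)
qed

lemma L_sum:
  assumes "finite u" "finite S" "\<And>w. w \<in> S \<Longrightarrow> g w \<in> L u"
  shows "(\<lambda>t. \<Sum>w\<in>S. r w * g w t) \<in> L u"
    and "N u (\<lambda>t. \<Sum>w\<in>S. r w * g w t) \<le> (\<Sum>w\<in>S. \<bar>r w\<bar> * N u (g w))"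
proof -
  have "(\<lambda>t. \<Sum>w\<in>S. r w * g w t) \<in> L u \<and>
    N u (\<lambda>t. \<Sum>w\<in>S. r w * g w t) \<le> (\<Sum>w\<in>S. \<bar>r w\<bar> * N u (g w))"
    using assms(2,3)
  proof (induction S rule: finite_induct)
    case empty
    then show ?case using zero_in_L[OF assms(1)] by simp
  next
    case (insert w S)
    note * = L_scale[OF assms(1), of "g w" "r w"]
    have "(\<lambda>t. r w * g w t + (\<Sum>w\<in>S. r w * g w t)) \<in> L u"
      using insert * by (intro L_add assms) auto
    moreover have "N u (\<lambda>t. r w * g w t + (\<Sum>w\<in>S. r w * g w t))
        \<le> N u (\<lambda>t. r w * g w t) + N u (\<lambda>t. \<Sum>w\<in>S. r w * g w t)"
      using insert * by (intro L_add assms) auto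
    moreover have "N u (\<lambda>t. \<Sum>w\<in>S. r w * g w t) \<le> (\<Sum>w\<in>S. \<bar>r w\<bar> * N u (g w))"
      using insert by auto
    ultimately show ?case
      using insert * by simp
  qed
  then show "(\<lambda>t. \<Sum>w\<in>S. r w * g w t) \<in> L u"
    "N u (\<lambda>t. \<Sum>w\<in>S. r w * g w t) \<le> (\<Sum>w\<in>S. \<bar>r w\<bar> * N u (g w))"
    by auto
qed

lemma N_eq_0_AE:
  assumes "finite u" "g \<in> L u" "N u g = 0"
  shows "AE t in prod_M u. g t = 0"
proof (cases "p = 1")
  case True
  note [measurable] = L_measurable[OF assms(2)]
  have "integrable (prod_M u) (\<lambda>t. \<bar>g t * wt u t\<bar>)"
    using assms True by (simp add: L1_iff)
  moreover have "(LINT t|prod_M u. \<bar>g t * wt u t\<bar>) = (LINT t|prod_M u. \<bar>g t\<bar> * wt u t)"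
    by (intro Bochner_Integration.integral_cong refl) (use wt_nonneg in \<open>auto simp: abs_mult\<close>)
  ultimately have "AE t in prod_M u. \<bar>g t * wt u t\<bar> = 0"
    using assms True by (simp add: N1_eq integral_nonneg_eq_0_iff_AE del: abs_eq_0_iff)
  moreover have "AE t in prod_M u. \<forall>j\<in>u. 0 < \<psi> (t j)"
    using assms \<psi>_pos by (intro AE_prod_all)
  ultimately show ?thesis
    by eventually_elim (use assms(1) in auto)
next
  case False
  then have "p = \<infinity>" using p_cases by auto
  then show ?thesis
    using Ninf_AE[of u g] assms by auto
qed

text \<open>One-variable factors whose tensor products pair integrably with \<open>L u\<close>:
  unweighted \<open>L\<^sub>1\<close> for p = \<infinity>, and functions dominated by a multiple of
  \<psi> for p = 1. The tail integral and, later, both kernels are of this kind.\<close>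

definition admissible :: "('b \<Rightarrow> real) \<Rightarrow> bool" where
  "admissible a \<longleftrightarrow> a \<in> borel_measurable M \<and>
    (if p = \<infinity> then integrable M a else \<exists>C. AE t in M. \<bar>a t\<bar> \<le> C * \<psi> t)"

lemma admissible_b: "admissible b"
proof (cases "p = \<infinity>")
  case False
  then obtain C where "AE t in M. b t \<le> C * \<psi> t"
    using p_cases b_bounded by auto
  then have "AE t in M. \<bar>b t\<bar> \<le> C * \<psi> t"
    by (rule AE_mp) (auto intro!: AE_I2 simp: b_nonneg)
  with False show ?thesis
    by (auto simp: admissible_def)
qed (use b_integrable in \<open>unfold admissible_def, simp\<close>)

text \<open>With \<psi> itself as factor, the weighted \<open>L\<^sub>1\<close> norm becomes such a
  pairing, so that Fubini for \<open>P\<close> also serves norm estimates.\<close>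

lemma admissible_\<psi>: "p = 1 \<Longrightarrow> admissible \<psi>"
  unfolding admissible_def by (auto simp: \<psi>_nonneg intro!: exI[of _ 1] AE_I2)

lemma admissible_bounded_by:
  assumes "admissible a" "a' \<in> borel_measurable M" "\<And>t. t \<in> space M \<Longrightarrow> \<bar>a' t\<bar> \<le> \<bar>a t\<bar>"
  shows "admissible a'"
proof (cases "p = \<infinity>")
  case True
  then show ?thesis
    using assms unfolding admissible_def by (auto intro: Bochner_Integration.integrable_bound)
next
  case False
  then obtain C where "AE t in M. \<bar>a t\<bar> \<le> C * \<psi> t"
    using assms by (auto simp: admissible_def)
  then have "AE t in M. \<bar>a' t\<bar> \<le> C * \<psi> t"
    by (rule AE_mp) (use assms(3) in \<open>force intro!: AE_I2\<close>)
  with False assms(2) show ?thesis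
    by (auto simp: admissible_def)
qed

lemma admissible_diff:
  assumes "admissible a" "admissible a'"
  shows "admissible (\<lambda>t. a t - a' t)"
proof (cases "p = \<infinity>")
  case True
  then show ?thesis
    using assms unfolding admissible_def by auto
next
  case False
  then obtain C C' where "AE t in M. \<bar>a t\<bar> \<le> C * \<psi> t" "AE t in M. \<bar>a' t\<bar> \<le> C' * \<psi> t"
    using assms unfolding admissible_def by auto
  then have "AE t in M. \<bar>a t - a' t\<bar> \<le> (C + C') * \<psi> t"
    by eventually_elim (simp add: distrib_right)
  then show ?thesis
    using assms False unfolding admissible_def by auto
qed

text \<open>For p = \<infinity> the component is essentially bounded and the product of integrable
  factors is integrable. For p = 1 the product of the factors is dominated by a constant times the
  weight, against which the component is integrable.\<close>

lemma integrable_admissible: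
  assumes u: "finite u" and g: "g \<in> L u" and a: "\<And>j. j \<in> u \<Longrightarrow> admissible (a j)"
  shows "integrable (prod_M u) (\<lambda>t. g t * (\<Prod>j\<in>u. a j (t j)))"
proof -
  note [measurable] = L_measurable[OF g]
  have [measurable]: "(\<lambda>t. \<Prod>j\<in>u. a j (t j)) \<in> borel_measurable (prod_M u)"
    using a by (intro prod_measurable) (auto simp: admissible_def)
  show ?thesis
  proof (cases "p = \<infinity>")
    case True
    have ia: "integrable (prod_M u) (\<lambda>t. N u g * (\<Prod>j\<in>u. a j (t j)))"
      using a True u unfolding admissible_def by (intro integrable_mult_right product_integrable_prod) auto
    show ?thesis
      using Ninf_AE[OF True u g]
      by (intro Bochner_Integration.integrable_bound[OF ia])
        (auto simp: abs_mult elim!: eventually_mono intro!: mult_right_mono)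
  next
    case False
    then have p: "p = 1" using p_cases by auto
    have "\<forall>j\<in>u. \<exists>C. AE t in M. \<bar>a j t\<bar> \<le> C * \<psi> t"
      using a False by (auto simp: admissible_def)
    then obtain C where C: "\<And>j. j \<in> u \<Longrightarrow> AE t in M. \<bar>a j t\<bar> \<le> C j * \<psi> t"
      by metis
    have "AE t in prod_M u. \<forall>j\<in>u. \<bar>a j (t j)\<bar> \<le> C j * \<psi> (t j)"
      using u C by (intro AE_prod_all)
    then have "AE t in prod_M u. norm (g t * (\<Prod>j\<in>u. a j (t j))) \<le> norm ((\<Prod>j\<in>u. C j) * (g t * wt u t))"
    proof eventually_elim
      case (elim t)
      have "(\<Prod>j\<in>u. \<bar>a j (t j)\<bar>) \<le> (\<Prod>j\<in>u. C j * \<psi> (t j))"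
        using elim by (intro prod_mono) auto
      also have "\<dots> \<le> \<bar>(\<Prod>j\<in>u. C j) * wt u t\<bar>"
        by (simp add: prod.distrib)
      finally have "\<bar>g t\<bar> * (\<Prod>j\<in>u. \<bar>a j (t j)\<bar>) \<le> \<bar>g t\<bar> * \<bar>(\<Prod>j\<in>u. C j) * wt u t\<bar>"
        by (rule mult_left_mono) simp
      then show ?case
        by (simp add: abs_mult abs_prod mult_ac)
    qed
    moreover have "integrable (prod_M u) (\<lambda>t. (\<Prod>j\<in>u. C j) * (g t * wt u t))"
      using g u p by (simp add: L1_iff)
    moreover have "(\<lambda>t. g t * (\<Prod>j\<in>u. a j (t j))) \<in> borel_measurable (prod_M u)"
      by measurable
    ultimately show ?thesis
      by (rule Bochner_Integration.integrable_bound[rotated 2])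
  qed
qed

section \<open>Partial integration\<close>

definition P :: "nat set \<Rightarrow> nat set \<Rightarrow> ((nat \<Rightarrow> 'b) \<Rightarrow> real) \<Rightarrow> (nat \<Rightarrow> 'b) \<Rightarrow> real" where
  "P w u g t = (LINT s|prod_M (w - u). g (merge u (w - u) (t, s)) * (\<Prod>j\<in>w - u. b (s j)))"

lemma pair_sigma_finite_prod_M:
  assumes "finite u" "finite v"
  shows "pair_sigma_finite (prod_M u) (prod_M v)"
  using assms by (intro pair_sigma_finite.intro sigma_finite)

lemma measurable_merge_subset:
  assumes "u \<subseteq> w"
  shows "merge u (w - u) \<in> measurable (prod_M u \<Otimes>\<^sub>M prod_M (w - u)) (prod_M w)"
  using measurable_merge[of u "w - u" "\<lambda>_. M"] assms by (simp add: Un_absorb1)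

lemma P_measurable:
  assumes "finite w" "u \<subseteq> w" and g [measurable]: "g \<in> borel_measurable (prod_M w)"
  shows "P w u g \<in> borel_measurable (prod_M u)"
proof -
  interpret pair_sigma_finite "prod_M u" "prod_M (w - u)"
    using assms finite_subset by (intro pair_sigma_finite_prod_M) auto
  note [measurable] = measurable_merge_subset[OF assms(2)]
  have [measurable]: "(\<lambda>s. \<Prod>j\<in>w - u. b (s j)) \<in> borel_measurable (prod_M (w - u))"
    by (intro prod_measurable) auto
  show ?thesis
    unfolding P_def[abs_def] by measurable
qed

text \<open>Almost every slice of a null set is null. The product over \<open>w\<close> is the image
  under \<open>merge\<close> of the product over the retained and the integrated variables.\<close>

lemma AE_prod_merge:
  assumes "finite w" "u \<subseteq> w" "AE x in prod_M w. Q x"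
  shows "AE t in prod_M u. AE s in prod_M (w - u). Q (merge u (w - u) (t, s))"
proof -
  have fin: "finite u" "finite (w - u)"
    using assms finite_subset by auto
  interpret pair_sigma_finite "prod_M u" "prod_M (w - u)"
    using fin by (rule pair_sigma_finite_prod_M)
  have "distr (prod_M u \<Otimes>\<^sub>M prod_M (w - u)) (prod_M w) (merge u (w - u)) = prod_M w"
    using distr_merge[of u "w - u"] fin assms(2) by (simp add: Un_absorb1)
  then have "AE x in distr (prod_M u \<Otimes>\<^sub>M prod_M (w - u)) (prod_M w) (merge u (w - u)). Q x"
    using assms(3) by (simp only:)
  then have "AE x in prod_M u \<Otimes>\<^sub>M prod_M (w - u). Q (merge u (w - u) x)"
    by (rule AE_distrD[OF measurable_merge_subset[OF assms(2)]])
  then show ?thesis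
    by (rule AE_pair)
qed

text \<open>The retained variables carry arbitrary admissible factors, the integrated ones carry
  \<open>b\<close>. Kernels as factors give the expansion of the operators \<open>T_op\<close>, and
  the factor \<psi> gives the \<open>L\<^sub>1\<close> bound for \<open>P\<close>.\<close>

lemma P_Fubini:
  assumes w: "finite w" "u \<subseteq> w" and g: "g \<in> L w" and a: "\<And>j. j \<in> u \<Longrightarrow> admissible (a j)"
  shows "integrable (prod_M u) (\<lambda>t. P w u g t * (\<Prod>j\<in>u. a j (t j)))"
    and "integrable (prod_M w) (\<lambda>x. g x * ((\<Prod>j\<in>u. a j (x j)) * (\<Prod>j\<in>w - u. b (x j))))"
    and "(LINT x|prod_M w. g x * ((\<Prod>j\<in>u. a j (x j)) * (\<Prod>j\<in>w - u. b (x j))))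
      = (LINT t|prod_M u. P w u g t * (\<Prod>j\<in>u. a j (t j)))"
proof -
  have fin: "finite u" "finite (w - u)"
    using assms finite_subset by auto
  interpret pair_sigma_finite "prod_M u" "prod_M (w - u)"
    using fin by (rule pair_sigma_finite_prod_M)
  define F where "F x = g x * ((\<Prod>j\<in>u. a j (x j)) * (\<Prod>j\<in>w - u. b (x j)))" for x
  \<comment> \<open>The two products are joined into one with a factor per coordinate of
    \<open>w\<close>, the form that \<open>integrable_admissible\<close> handles.\<close>
  have F_eq: "F x = g x * (\<Prod>j\<in>w. (if j \<in> u then a j else b) (x j))" for x
  proof -
    have "(\<Prod>j\<in>w. (if j \<in> u then a j else b) (x j))
        = (\<Prod>j\<in>w - u. (if j \<in> u then a j else b) (x j)) * (\<Prod>j\<in>u. (if j \<in> u then a j else b) (x j))"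
      by (rule prod.subset_diff[OF w(2,1)])
    then show ?thesis
      by (simp add: F_def mult_ac)
  qed
  have "integrable (prod_M w) F"
    unfolding F_eq[abs_def] using a admissible_b by (intro integrable_admissible w g) auto
  then show iF: "integrable (prod_M w) (\<lambda>x. g x * ((\<Prod>j\<in>u. a j (x j)) * (\<Prod>j\<in>w - u. b (x j))))"
    by (simp add: F_def[abs_def])
  have inner: "(LINT s|prod_M (w - u). F (merge u (w - u) (t, s))) = P w u g t * (\<Prod>j\<in>u. a j (t j))" for t
  proof -
    have "(LINT s|prod_M (w - u). F (merge u (w - u) (t, s)))
      = (LINT s|prod_M (w - u). (g (merge u (w - u) (t, s)) * (\<Prod>j\<in>w - u. b (s j))) * (\<Prod>j\<in>u. a j (t j)))"
      by (intro Bochner_Integration.integral_cong refl) (simp add: F_def mult_ac)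
    then show ?thesis
      by (simp add: P_def)
  qed
  have dist: "distr (prod_M u \<Otimes>\<^sub>M prod_M (w - u)) (prod_M w) (merge u (w - u)) = prod_M w"
    using distr_merge[of u "w - u"] fin assms(2) by (simp add: Un_absorb1)
  have "integrable (prod_M u \<Otimes>\<^sub>M prod_M (w - u)) (\<lambda>x. F (merge u (w - u) x))"
    by (rule integrable_distr[OF measurable_merge_subset[OF w(2)]])
      (simp add: dist \<open>integrable (prod_M w) F\<close>)
  from integrable_fst'[OF this]
  show "integrable (prod_M u) (\<lambda>t. P w u g t * (\<Prod>j\<in>u. a j (t j)))"
    by (simp add: inner)
  have "integral\<^sup>L (prod_M (u \<union> (w - u))) F
      = (LINT t|prod_M u. LINT s|prod_M (w - u). F (merge u (w - u) (t, s)))"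
    using fin \<open>integrable (prod_M w) F\<close> w(2) by (intro product_integral_fold) (auto simp: Un_absorb1)
  then have "integral\<^sup>L (prod_M w) F
      = (LINT t|prod_M u. LINT s|prod_M (w - u). F (merge u (w - u) (t, s)))"
    using w(2) by (simp add: Un_absorb1)
  then show "(LINT x|prod_M w. g x * ((\<Prod>j\<in>u. a j (x j)) * (\<Prod>j\<in>w - u. b (x j))))
      = (LINT t|prod_M u. P w u g t * (\<Prod>j\<in>u. a j (t j)))"
    by (simp only: inner) (simp only: F_def[abs_def])
qed

section \<open>The norm of partial integration\<close>

definition c :: real where
  "c = (if p = \<infinity> then LINT t|M. b t else Lp_norm \<infinity> M (\<lambda>t. b t / \<psi> t))"

text \<open>Where \<psi> is positive, b / \<psi> \<le> C and b \<le> C * \<psi> say the same. The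
  form without quotient multiplies directly over coordinates, and it identifies \<open>c\<close> as
  the least essential bound.\<close>

lemma c_le_iff:
  assumes "p = 1"
  shows "c \<le> C \<longleftrightarrow> (AE t in M. b t \<le> C * \<psi> t)"
proof -
  obtain C\<^sub>0 where C\<^sub>0: "AE t in M. b t \<le> C\<^sub>0 * \<psi> t"
    using assms b_bounded by auto
  have iff: "(AE t in M. \<bar>b t / \<psi> t\<bar> \<le> C) \<longleftrightarrow> (AE t in M. b t \<le> C * \<psi> t)" for C
  proof (rule eventually_cong)
    show "AE t in M. t \<in> space M \<and> 0 < \<psi> t"
      using \<psi>_pos by simp
    show "(\<bar>b t / \<psi> t\<bar> \<le> C) \<longleftrightarrow> (b t \<le> C * \<psi> t)" if "t \<in> space M \<and> 0 < \<psi> t" for t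
      using that b_nonneg[of t] by (simp add: field_simps)
  qed
  show ?thesis
    unfolding c_def using assms iff C\<^sub>0 M_nonnull
    by (subst if_not_P, simp, subst Lp_norm_infinity_le_iff[of _ _ C\<^sub>0]) auto
qed

lemma c_AE: "p = 1 \<Longrightarrow> AE t in M. b t \<le> c * \<psi> t"
  using c_le_iff[of c] by simp

lemma c_nonneg: "0 \<le> c"
proof (cases "p = \<infinity>")
  case True
  then show ?thesis
    unfolding c_def by (auto simp: b_nonneg intro!: integral_nonneg_AE AE_I2)
next
  case False
  then have p: "p = 1" using p_cases by auto
  show ?thesis
  proof (rule ccontr)
    assume neg: "\<not> 0 \<le> c"
    have "AE t in M. t \<in> space M \<and> 0 < \<psi> t"
      using \<psi>_pos by simp
    with c_AE[OF p] have "AE t in M. False"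
    proof eventually_elim
      case (elim t)
      then have "c * \<psi> t < 0" using neg by (simp add: mult_neg_pos)
      with elim b_nonneg[of t] show False by auto
    qed
    then show False
      using M_nonnull by (simp add: AE_False_iff)
  qed
qed

lemma prod_b_le:
  assumes "p = 1" "finite w" "u \<subseteq> w"
  shows "AE x in prod_M w. (\<Prod>j\<in>u. \<psi> (x j)) * (\<Prod>j\<in>w - u. b (x j)) \<le> c ^ card (w - u) * wt w x"
proof -
  have "AE x in prod_M w. \<forall>j\<in>w. b (x j) \<le> c * \<psi> (x j)"
    using assms c_AE by (intro AE_prod_all) auto
  then have "AE x in prod_M w. x \<in> space (prod_M w) \<and> (\<forall>j\<in>w. b (x j) \<le> c * \<psi> (x j))"
    by simp
  then show ?thesis
  proof eventually_elim
    case (elim x)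
    then have x: "x j \<in> space M" if "j \<in> w" for j
      using that by (auto simp: space_PiM)
    have "(\<Prod>j\<in>w - u. b (x j)) \<le> (\<Prod>j\<in>w - u. c * \<psi> (x j))"
      using elim x by (intro prod_mono) (auto simp: b_nonneg)
    also have "\<dots> = c ^ card (w - u) * (\<Prod>j\<in>w - u. \<psi> (x j))"
      by (simp add: prod.distrib)
    finally have "(\<Prod>j\<in>u. \<psi> (x j)) * (\<Prod>j\<in>w - u. b (x j))
        \<le> (\<Prod>j\<in>u. \<psi> (x j)) * (c ^ card (w - u) * (\<Prod>j\<in>w - u. \<psi> (x j)))"
      using x assms(3) by (intro mult_left_mono prod_nonneg) (auto simp: \<psi>_nonneg)
    also have "\<dots> = c ^ card (w - u) * wt w x"
      by (subst prod.subset_diff[OF assms(3,2)]) (simp add: mult_ac)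
    finally show ?case .
  qed
qed

text \<open>For p = \<infinity> almost every slice of \<open>g\<close> is bounded by
  \<open>N w g\<close>, and each integrated variable contributes \<integral> b = c. For p = 1 the
  integral of the absolute value is carried back to \<open>w\<close> by Fubini, where b \<le> c *
  \<psi> is used in each integrated variable.\<close>

lemma P_norm:
  assumes w: "finite w" "u \<subseteq> w" and g: "g \<in> L w"
  shows "P w u g \<in> L u" and "N u (P w u g) \<le> c ^ card (w - u) * N w g"
proof -
  have fin: "finite u" "finite (w - u)"
    using assms finite_subset by auto
  note gm [measurable] = L_measurable[OF g]
  have Pm [measurable]: "P w u g \<in> borel_measurable (prod_M u)"
    by (rule P_measurable[OF w gm])
  have *: "P w u g \<in> L u \<and> N u (P w u g) \<le> c ^ card (w - u) * N w g"
  proof (cases "p = \<infinity>")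
    case True
    have "AE t in prod_M u. AE s in prod_M (w - u). \<bar>g (merge u (w - u) (t, s))\<bar> \<le> N w g"
      by (rule AE_prod_merge[OF w Ninf_AE[OF True w(1) g]])
    then have "AE t in prod_M u. t \<in> space (prod_M u) \<and>
        (AE s in prod_M (w - u). \<bar>g (merge u (w - u) (t, s))\<bar> \<le> N w g)"
      by simp
    then have ae: "AE t in prod_M u. \<bar>P w u g t\<bar> \<le> c ^ card (w - u) * N w g"
    proof eventually_elim
      case (elim t)
      have int: "integrable (prod_M (w - u)) (\<lambda>s. N w g * (\<Prod>j\<in>w - u. b (s j)))"
        using fin True b_integrable by (intro integrable_mult_right product_integrable_prod) auto
      have "\<bar>P w u g t\<bar> \<le> (LINT s|prod_M (w - u). \<bar>g (merge u (w - u) (t, s)) * (\<Prod>j\<in>w - u. b (s j))\<bar>)"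
        unfolding P_def by (rule integral_abs_bound)
      also have "\<dots> \<le> (LINT s|prod_M (w - u). N w g * (\<Prod>j\<in>w - u. b (s j)))"
      proof (rule integral_mono_AE')
        have "AE s in prod_M (w - u). s \<in> space (prod_M (w - u)) \<and> \<bar>g (merge u (w - u) (t, s))\<bar> \<le> N w g"
          using elim by simp
        then show "AE s in prod_M (w - u). \<bar>g (merge u (w - u) (t, s)) * (\<Prod>j\<in>w - u. b (s j))\<bar>
            \<le> N w g * (\<Prod>j\<in>w - u. b (s j))"
        proof eventually_elim
          case (elim s)
          then show ?case
            using prod_b_nonneg[of s "w - u"] by (simp add: abs_mult mult_right_mono)
        qed
        show "AE s in prod_M (w - u). 0 \<le> N w g * (\<Prod>j\<in>w - u. b (s j))"
          using prod_b_nonneg N_nonneg[OF w(1) g] by (intro AE_I2 mult_nonneg_nonneg) auto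
      qed (rule int)
      also have "\<dots> = N w g * (\<Prod>j\<in>w - u. LINT t|M. b t)"
        using product_integral_prod[of "w - u" "\<lambda>_. b"] fin True b_integrable by simp
      also have "\<dots> = c ^ card (w - u) * N w g"
        unfolding c_def using True by simp
      finally show ?case .
    qed
    then have "P w u g \<in> L u"
      using True fin by (auto simp: Linf_iff)
    then show ?thesis
      using Ninf_le_iff[OF True fin(1)] ae by blast
  next
    case False
    then have p: "p = 1" using p_cases by auto
    have g_abs: "(\<lambda>x. \<bar>g x\<bar>) \<in> L w"
    proof -
      have "integrable (prod_M w) (\<lambda>x. \<bar>g x * wt w x\<bar>)"
        using g p w by (simp add: L1_iff)
      then have "integrable (prod_M w) (\<lambda>x. \<bar>g x\<bar> * wt w x)"
        by (rule iffD1[OF Bochner_Integration.integrable_cong, rotated 2])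
          (use wt_nonneg in \<open>auto simp: abs_mult\<close>)
      then show ?thesis
        using p w by (simp add: L1_iff)
    qed
    have mem: "P w u g \<in> L u"
      using P_Fubini(1)[OF w g, of "\<lambda>_. \<psi>"] admissible_\<psi> p fin by (simp add: L1_iff)
    have "N u (P w u g) = (LINT t|prod_M u. \<bar>P w u g t\<bar> * wt u t)"
      using p fin by (simp add: N1_eq)
    also have "\<dots> \<le> (LINT t|prod_M u. P w u (\<lambda>x. \<bar>g x\<bar>) t * wt u t)"
    proof (rule integral_mono')
      show "integrable (prod_M u) (\<lambda>t. P w u (\<lambda>x. \<bar>g x\<bar>) t * wt u t)"
        using P_Fubini(1)[OF w g_abs, of "\<lambda>_. \<psi>"] admissible_\<psi> p by simp
      \<comment> \<open>Since \<open>b\<close> is nonnegative, \<open>P\<close> is monotone; with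
        the absolute value inside, Fubini can undo the partial integration.\<close>
      have "\<bar>P w u g t\<bar> \<le> P w u (\<lambda>x. \<bar>g x\<bar>) t" for t
      proof -
        have "\<bar>P w u g t\<bar> \<le> (LINT s|prod_M (w - u). \<bar>g (merge u (w - u) (t, s)) * (\<Prod>j\<in>w - u. b (s j))\<bar>)"
          unfolding P_def by (rule integral_abs_bound)
        also have "\<dots> = P w u (\<lambda>x. \<bar>g x\<bar>) t"
          unfolding P_def using prod_b_nonneg[of _ "w - u"]
          by (intro Bochner_Integration.integral_cong refl) (simp add: abs_mult)
        finally show ?thesis .
      qed
      then show "\<bar>P w u g t\<bar> * wt u t \<le> P w u (\<lambda>x. \<bar>g x\<bar>) t * wt u t" if "t \<in> space (prod_M u)" for t
        using wt_nonneg[OF that] by (rule mult_right_mono)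
      show "0 \<le> P w u (\<lambda>x. \<bar>g x\<bar>) t * wt u t" if "t \<in> space (prod_M u)" for t
        using wt_nonneg[OF that] prod_b_nonneg[of _ "w - u"]
        by (auto simp: P_def intro!: mult_nonneg_nonneg integral_nonneg_AE)
    qed
    also have "\<dots> = (LINT x|prod_M w. \<bar>g x\<bar> * (wt u x * (\<Prod>j\<in>w - u. b (x j))))"
      using P_Fubini(3)[OF w g_abs, of "\<lambda>_. \<psi>"] admissible_\<psi> p by simp
    also have "\<dots> \<le> (LINT x|prod_M w. c ^ card (w - u) * (\<bar>g x\<bar> * wt w x))"
    proof (rule integral_mono_AE)
      show "integrable (prod_M w) (\<lambda>x. \<bar>g x\<bar> * (wt u x * (\<Prod>j\<in>w - u. b (x j))))"
        using P_Fubini(2)[OF w g_abs, of "\<lambda>_. \<psi>"] admissible_\<psi> p by simp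
      show "integrable (prod_M w) (\<lambda>x. c ^ card (w - u) * (\<bar>g x\<bar> * wt w x))"
        using g_abs p w by (simp add: L1_iff)
      show "AE x in prod_M w. \<bar>g x\<bar> * (wt u x * (\<Prod>j\<in>w - u. b (x j)))
          \<le> c ^ card (w - u) * (\<bar>g x\<bar> * wt w x)"
        using prod_b_le[OF p w]
      proof eventually_elim
        case (elim x)
        from mult_left_mono[OF this, of "\<bar>g x\<bar>"] show ?case by (simp add: mult_ac)
      qed
    qed
    also have "\<dots> = c ^ card (w - u) * N w g"
      using p w by (simp add: N1_eq)
    finally show ?thesis
      using mem by simp
  qed
  then show "P w u g \<in> L u" "N u (P w u g) \<le> c ^ card (w - u) * N w g" by auto
qed

text \<open>No variable is integrated: the product over the empty index set is a single point of
  mass 1. This is the unit diagonal of the change of components.\<close>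

lemma P_self:
  assumes "t \<in> space (prod_M u)"
  shows "P u u g t = g t"
proof -
  have "merge u {} (t, s) = t" for s
    using assms by (auto simp: merge_def fun_eq_iff space_PiM PiE_def extensional_def)
  then show ?thesis
    by (simp add: P_def PiM_empty lebesgue_integral_count_space_finite)
qed

text \<open>A component that vanishes a.e. has norm 0, and the norm bound passes this on, so
  \<open>P\<close> respects equality almost everywhere.\<close>

lemma P_AE_zero:
  assumes "finite w" "u \<subseteq> w" "g \<in> L w" "AE x in prod_M w. g x = 0"
  shows "AE t in prod_M u. P w u g t = 0"
proof -
  have "AE x in prod_M w. 0 = g x"
    using assms(4) by (rule eventually_mono) simp
  then have "N w g = 0"
    using N_cong(2)[OF assms(1) zero_in_L(1)[OF assms(1)] L_measurable[OF assms(3)]]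
      zero_in_L(2)[OF assms(1)] by simp
  then have "N u (P w u g) \<le> 0"
    using P_norm(2)[OF assms(1-3)] by simp
  then show ?thesis
    using P_norm(1)[OF assms(1-3)] finite_subset[OF assms(2,1)]
    by (intro N_eq_0_AE order.antisym N_nonneg)
qed

section \<open>Tensor powers that nearly attain the norm\<close>

text \<open>For \<open>p = \<infinity>\<close> the constant \<open>1\<close> already attains \<open>c\<close>.\<close>

definition test :: "('b \<Rightarrow> real) \<Rightarrow> bool" where
  "test \<phi> \<longleftrightarrow> \<phi> \<in> borel_measurable M \<and> (\<forall>t\<in>space M. 0 \<le> \<phi> t) \<and> integrable M (\<lambda>t. \<phi> t * b t) \<and>
    (if p = \<infinity> then \<phi> = (\<lambda>_. 1) else has_bochner_integral M (\<lambda>t. \<phi> t * \<psi> t) 1)"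

lemma test_norm:
  assumes "finite u" "test \<phi>"
  shows "(\<lambda>t. \<Prod>j\<in>u. \<phi> (t j)) \<in> L u" and "N u (\<lambda>t. \<Prod>j\<in>u. \<phi> (t j)) = 1"
proof -
  have [measurable]: "(\<lambda>t. \<Prod>j\<in>u. \<phi> (t j)) \<in> borel_measurable (prod_M u)"
    using assms(2) by (intro prod_measurable) (auto simp: test_def)
  have "(\<lambda>t. \<Prod>j\<in>u. \<phi> (t j)) \<in> L u \<and> N u (\<lambda>t. \<Prod>j\<in>u. \<phi> (t j)) = 1"
  proof (cases "p = \<infinity>")
    case True
    then have \<phi>: "\<phi> = (\<lambda>_. 1)" using assms(2) unfolding test_def by simp
    have mem: "(\<lambda>_. 1) \<in> L u"
      using True assms by (auto simp: Linf_iff)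
    have "N u (\<lambda>_. 1) \<le> C \<longleftrightarrow> 1 \<le> C" for C
      using Ninf_le_iff[OF True assms(1) mem, of C] prod_M_nonnull[OF assms(1)] AE_False_iff[of "prod_M u"]
      by (cases "1 \<le> C") auto
    then have "N u (\<lambda>_. 1) = 1"
      by (meson order.antisym order.refl)
    with mem \<phi> show ?thesis by simp
  next
    case False
    then have p: "p = 1" using p_cases by auto
    have int: "integrable M (\<lambda>t. \<phi> t * \<psi> t)" "(LINT t|M. \<phi> t * \<psi> t) = 1"
      using assms False by (auto simp: test_def has_bochner_integral_iff)
    have "integrable (prod_M u) (\<lambda>t. \<Prod>j\<in>u. \<phi> (t j) * \<psi> (t j))"
      using assms int by (intro product_integrable_prod)
    then have mem: "(\<lambda>t. \<Prod>j\<in>u. \<phi> (t j)) \<in> L u"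
      using p assms by (simp add: L1_iff prod.distrib)
    have "N u (\<lambda>t. \<Prod>j\<in>u. \<phi> (t j)) = (LINT t|prod_M u. (\<Prod>j\<in>u. \<phi> (t j) * \<psi> (t j)))"
    proof -
      have "\<bar>\<Prod>j\<in>u. \<phi> (t j)\<bar> = (\<Prod>j\<in>u. \<phi> (t j))" if "t \<in> space (prod_M u)" for t
        using assms(2) that by (intro abs_of_nonneg prod_nonneg) (auto simp: test_def space_PiM)
      then show ?thesis
        using p assms(1) by (simp add: N1_eq prod.distrib cong: Bochner_Integration.integral_cong)
    qed
    also have "\<dots> = 1"
      using product_integral_prod[of u "\<lambda>_ t. \<phi> t * \<psi> t"] assms(1) int by simp
    finally show ?thesis using mem by simp
  qed
  then show "(\<lambda>t. \<Prod>j\<in>u. \<phi> (t j)) \<in> L u" "N u (\<lambda>t. \<Prod>j\<in>u. \<phi> (t j)) = 1" by auto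
qed

lemma P_test:
  assumes "finite w" "u \<subseteq> w" "test \<phi>"
  shows "P w u (\<lambda>t. \<Prod>j\<in>w. \<phi> (t j)) t = (LINT s|M. \<phi> s * b s) ^ card (w - u) * (\<Prod>j\<in>u. \<phi> (t j))"
proof -
  have "(\<Prod>j\<in>w. \<phi> (merge u (w - u) (t, s) j)) = (\<Prod>j\<in>w - u. \<phi> (s j)) * (\<Prod>j\<in>u. \<phi> (t j))" for s
    by (subst prod.subset_diff[OF assms(2,1)]) simp
  then have "P w u (\<lambda>t. \<Prod>j\<in>w. \<phi> (t j)) t
    = (LINT s|prod_M (w - u). (\<Prod>j\<in>w - u. \<phi> (s j) * b (s j)) * (\<Prod>j\<in>u. \<phi> (t j)))"
    unfolding P_def
    by (intro Bochner_Integration.integral_cong refl) (simp add: prod.distrib mult_ac)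
  also have "\<dots> = (LINT s|prod_M (w - u). (\<Prod>j\<in>w - u. \<phi> (s j) * b (s j))) * (\<Prod>j\<in>u. \<phi> (t j))"
    by simp
  also have "(LINT s|prod_M (w - u). (\<Prod>j\<in>w - u. \<phi> (s j) * b (s j))) = (\<Prod>j\<in>w - u. LINT s|M. \<phi> s * b s)"
    using assms by (intro product_integral_prod) (auto simp: test_def)
  finally show ?thesis by simp
qed

text \<open>For p = 1 the norm of the functional may be approached without being attained. The test
  function is the indicator of the set where b / \<psi> exceeds c - \<epsilon>, divided by the
  weight of that set so that its norm is 1.\<close>

lemma test_approx:
  assumes "\<epsilon> > 0"
  shows "\<exists>\<phi>. test \<phi> \<and> c - \<epsilon> \<le> (LINT t|M. \<phi> t * b t) \<and> (LINT t|M. \<phi> t * b t) \<le> c"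
proof (cases "p = \<infinity>")
  case True
  then show ?thesis
    using assms b_integrable unfolding test_def c_def by (intro exI[of _ "\<lambda>_. 1"]) auto
next
  case False
  then have p: "p = 1" using p_cases by auto
  define B where "B = {t\<in>space M. (c - \<epsilon>) * \<psi> t < b t}"
  have [measurable]: "B \<in> sets M" unfolding B_def by measurable
  define r where "r = (LINT t|M. indicator B t * \<psi> t)"
  have i\<psi>: "integrable M (\<lambda>t. indicator B t * \<psi> t)"
    using integrable_mult_indicator[OF \<open>B \<in> sets M\<close> \<psi>_integrable] by simp
  \<comment> \<open>If \<open>B\<close> had weight 0, then c - \<epsilon> would be an essential
    upper bound of b / \<psi>, smaller than the least one.\<close>
  have "r \<noteq> 0"
  proof
    assume "r = 0"
    moreover have "AE t in M. 0 \<le> indicator B t * \<psi> t"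
      by (auto intro!: AE_I2 simp: \<psi>_nonneg)
    ultimately have "AE t in M. indicator B t * \<psi> t = 0"
      using i\<psi> by (simp add: r_def integral_nonneg_eq_0_iff_AE)
    moreover have "AE t in M. t \<in> space M \<and> 0 < \<psi> t"
      using \<psi>_pos by simp
    ultimately have "AE t in M. b t \<le> (c - \<epsilon>) * \<psi> t"
      by eventually_elim (auto simp: B_def indicator_def split: if_splits)
    then show False
      using c_le_iff[OF p, of "c - \<epsilon>"] assms by linarith
  qed
  moreover have "0 \<le> r"
    unfolding r_def by (intro integral_nonneg_AE) (auto intro!: AE_I2 simp: \<psi>_nonneg)
  ultimately have r: "0 < r" by simp
  define \<phi> where "\<phi> t = indicator B t / r" for t
  have \<phi>m [measurable]: "\<phi> \<in> borel_measurable M"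
    unfolding \<phi>_def by measurable
  have \<phi>_nonneg: "0 \<le> \<phi> t" for t
    using r by (simp add: \<phi>_def)
  have \<phi>\<psi>: "has_bochner_integral M (\<lambda>t. \<phi> t * \<psi> t) 1"
    using i\<psi> r by (simp add: has_bochner_integral_iff \<phi>_def r_def)
  have upper: "AE t in M. \<phi> t * b t \<le> c * (\<phi> t * \<psi> t)"
    using c_AE[OF p]
  proof eventually_elim
    case (elim t)
    from mult_left_mono[OF this \<phi>_nonneg[of t]] show ?case by (simp add: mult_ac)
  qed
  have ib: "integrable M (\<lambda>t. \<phi> t * b t)"
  proof (rule Bochner_Integration.integrable_bound)
    show "integrable M (\<lambda>t. c * (\<phi> t * \<psi> t))"
      using \<phi>\<psi> by (simp add: has_bochner_integral_iff)
    have "AE t in M. t \<in> space M \<and> \<phi> t * b t \<le> c * (\<phi> t * \<psi> t)"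
      using upper by simp
    then show "AE t in M. norm (\<phi> t * b t) \<le> norm (c * (\<phi> t * \<psi> t))"
    proof eventually_elim
      case (elim t)
      then have "norm (\<phi> t * b t) = \<phi> t * b t"
        using b_nonneg[of t] \<phi>_nonneg[of t] by simp
      then show ?case
        using elim abs_ge_self[of "c * (\<phi> t * \<psi> t)"] by (simp only: real_norm_def) linarith
    qed
  qed measurable
  have "test \<phi>"
    using \<phi>m \<phi>_nonneg ib \<phi>\<psi> False by (auto simp: test_def)
  moreover have "(LINT t|M. \<phi> t * b t) \<le> (LINT t|M. c * (\<phi> t * \<psi> t))"
    using ib \<phi>\<psi> upper by (intro integral_mono_AE) (auto simp: has_bochner_integral_iff)
  moreover have "(LINT t|M. (c - \<epsilon>) * (\<phi> t * \<psi> t)) \<le> (LINT t|M. \<phi> t * b t)"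
  proof (intro integral_mono)
    show "(c - \<epsilon>) * (\<phi> t * \<psi> t) \<le> \<phi> t * b t" if "t \<in> space M" for t
      using that r by (auto simp: \<phi>_def B_def indicator_def divide_right_mono)
  qed (use ib \<phi>\<psi> in \<open>auto simp: has_bochner_integral_iff\<close>)
  ultimately show ?thesis
    using \<phi>\<psi> by (auto simp: has_bochner_integral_iff)
qed

end

section \<open>Lebesgue measure on the interval\<close>

lemma sigma_finite_lebesgue_on:
  assumes "S \<in> sets lebesgue"
  shows "sigma_finite_measure (lebesgue_on S :: real measure)"
proof -
  have "sigma_finite_measure (lebesgue :: real measure)"
  proof
    show "\<exists>A. countable A \<and> A \<subseteq> sets (lebesgue :: real measure) \<and> \<Union> A = space lebesgue
        \<and> (\<forall>a\<in>A. emeasure lebesgue a \<noteq> \<infinity>)"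
    proof (intro exI[of _ "range (\<lambda>n. {- real n..real n})"] conjI)
      show "(\<Union>n. {- real n..real n}) = space lebesgue"
      proof -
        have "\<exists>n. - real n \<le> x \<and> x \<le> real n" for x
          using real_arch_simple[of "\<bar>x\<bar>"] by (metis abs_le_D1 abs_le_D2 minus_le_iff)
        then show ?thesis by fastforce
      qed
    qed auto
  qed
  then show ?thesis
    using assms by (rule sigma_finite_measure_restrict_space)
qed

text \<open>\<open>ennreal\<close> cuts off negative values, so the two integrals on the right are
  those of the positive and the negative part. A vanishing signed integral thus becomes an equality
  of two positive measures, and uniqueness theorems for measures apply.\<close>

lemma integral_eq_0_iff_nn_integral:
  fixes f :: "'a \<Rightarrow> real"
  assumes "integrable M f"
  shows "integral\<^sup>L M f = 0 \<longleftrightarrow> (\<integral>\<^sup>+x. f x \<partial>M) = (\<integral>\<^sup>+x. ennreal (- f x) \<partial>M)"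
proof -
  have "(\<integral>\<^sup>+x. f x \<partial>M) < \<infinity>" "(\<integral>\<^sup>+x. ennreal (- f x) \<partial>M) < \<infinity>"
    using assms by (auto simp: real_integrable_def less_top)
  then show ?thesis
    unfolding real_lebesgue_integral_def[OF assms]
    by (metis enn2real_eq_0_iff ennreal_enn2real eq_iff_diff_eq_0 infinity_ennreal_def)
qed

locale density_domain =
  fixes D :: "real set" and \<psi> :: "real \<Rightarrow> real" and p :: ereal
  assumes domain: "is_domain D"
    and density: "is_pos_density D \<psi>"
    and index: "p \<in> {1, \<infinity>}"
    and condition: "integrability_cond p D \<psi>"
begin

lemma D_nonneg: "t \<in> D \<Longrightarrow> 0 \<le> t"
  using domain by (auto simp: is_domain_def)

lemma D_0: "0 \<in> D"
  using domain by (auto simp: is_domain_def)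

lemma D_down: "x \<in> D \<Longrightarrow> 0 \<le> t \<Longrightarrow> t \<le> x \<Longrightarrow> t \<in> D"
  using domain by (auto simp: is_domain_def)

lemma D_borel: "D \<in> sets borel"
  using domain by (auto simp: is_domain_def)

lemma D_lebesgue: "D \<in> sets lebesgue"
  using D_borel by auto

lemma borel_subset_sets: "A \<in> sets borel \<Longrightarrow> A \<subseteq> D \<Longrightarrow> A \<in> sets (lebesgue_on D)"
  using D_lebesgue by (subst sets_restrict_space_iff) auto

lemma Ico_sets: "x \<in> D \<Longrightarrow> {0..<x} \<in> sets (lebesgue_on D)"
  using D_down by (intro borel_subset_sets) auto

lemma id_measurable: "(\<lambda>t. t) \<in> borel_measurable (lebesgue_on D)"
  using id_borel_measurable_lebesgue_on[of D] by (simp add: id_def)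

lemma psibar_eq: "t \<in> D \<Longrightarrow> psibar D \<psi> t = (LINT y|lebesgue_on D. indicator {t..} y * \<psi> y)"
  unfolding psibar_def using D_lebesgue
  by (subst (1 2) integral_restrict_space)
    (auto intro!: Bochner_Integration.integral_cong simp: indicator_def)

lemma \<psi>_facts:
  shows "integrable (lebesgue_on D) \<psi>" "AE y in lebesgue_on D. 0 < \<psi> y"
    "y \<in> D \<Longrightarrow> 0 \<le> \<psi> y" "\<psi> \<in> borel_measurable (lebesgue_on D)"
    "has_bochner_integral (lebesgue_on D) \<psi> 1"
  using density by (auto simp: is_pos_density_def has_bochner_integral_iff)

lemma psibar_nonneg: "t \<in> D \<Longrightarrow> 0 \<le> psibar D \<psi> t"
  unfolding psibar_eq using \<psi>_facts by (intro integral_nonneg_AE) (auto intro!: AE_I2)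

text \<open>The tail integral is decreasing because \<psi> is nonnegative. Its negative is therefore
  monotone and Borel on \<open>D\<close>, and Borel sets are Lebesgue measurable.\<close>

lemma psibar_measurable: "psibar D \<psi> \<in> borel_measurable (lebesgue_on D)"
proof -
  have int: "integrable (lebesgue_on D) (\<lambda>y. indicator {t..} y * \<psi> y)" for t
  proof (rule Bochner_Integration.integrable_bound[OF \<psi>_facts(1)])
    show "(\<lambda>y. indicator {t..} y * \<psi> y) \<in> borel_measurable (lebesgue_on D)"
      by (intro borel_measurable_times \<psi>_facts measurable_compose[OF id_measurable]) auto
  qed (auto simp: indicator_def)
  have "mono_on D (\<lambda>t. - psibar D \<psi> t)"
  proof (rule mono_onI)
    fix s t assume st: "s \<in> D" "t \<in> D" "s \<le> t"
    have "(LINT y|lebesgue_on D. indicator {t..} y * \<psi> y) \<le> (LINT y|lebesgue_on D. indicator {s..} y * \<psi> y)"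
      using st \<psi>_facts(3) by (intro integral_mono int) (auto simp: indicator_def)
    then show "- psibar D \<psi> s \<le> - psibar D \<psi> t"
      using st by (simp add: psibar_eq)
  qed
  then have "(\<lambda>t. - psibar D \<psi> t) \<in> borel_measurable (restrict_space borel D)"
    by (rule borel_measurable_mono_on_fnc)
  moreover have "sets (restrict_space borel D) \<subseteq> sets (lebesgue_on D)"
    unfolding sets_restrict_space by (intro image_mono) auto
  ultimately have "(\<lambda>t. - psibar D \<psi> t) \<in> borel_measurable (lebesgue_on D)"
    by (rule borel_measurable_subalgebra[rotated 2]) (simp add: space_restrict_space)
  then show ?thesis
    by simp
qed

lemma psibar_integrable:
  assumes "p = \<infinity>" shows "integrable (lebesgue_on D) (psibar D \<psi>)"
proof -
  have "integrable (lebesgue_on D) (\<lambda>t. \<bar>psibar D \<psi> t\<bar>)"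
    using condition assms by (auto simp: integrability_cond_def Lp_space_def)
  then show ?thesis
    using psibar_measurable by (simp add: integrable_abs_iff)
qed

lemma psibar_bounded:
  assumes "p = 1" shows "\<exists>C. AE t in lebesgue_on D. psibar D \<psi> t \<le> C * \<psi> t"
proof -
  have "(\<lambda>t. psibar D \<psi> t * \<psi> t powr -1) \<in> Lp_space \<infinity> (lebesgue_on D)"
    using condition assms by (auto simp: integrability_cond_def conj_index_def)
  from AE_bounded_if_esssup_finite[OF this]
  obtain C where "AE t in lebesgue_on D. \<bar>psibar D \<psi> t * \<psi> t powr -1\<bar> \<le> C"
    by blast
  with \<psi>_facts(2) have "AE t in lebesgue_on D. psibar D \<psi> t \<le> C * \<psi> t"
  proof eventually_elim
    case (elim t)
    then have "psibar D \<psi> t * \<psi> t powr -1 \<le> C" by linarith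
    then show ?case
      using elim by (simp add: powr_minus_divide field_simps)
  qed
  then show ?thesis ..
qed

sublocale weighted_measure "lebesgue_on D" \<psi> "psibar D \<psi>" p
proof (rule weighted_measure.intro)
  show "p = 1 \<or> p = \<infinity>"
    using index by auto
  show "sigma_finite_measure (lebesgue_on D)"
    by (rule sigma_finite_lebesgue_on[OF D_lebesgue])
qed (simp_all only: space_lebesgue_on \<psi>_facts psibar_nonneg psibar_measurable psibar_integrable psibar_bounded)

text \<open>For p = \<infinity> the bounded interval has finite measure. For p = 1 the local
  condition says that 1 / \<psi> is essentially bounded on {0..<x}, which is domination of the
  indicator by a multiple of \<psi>.\<close>

lemma admissible_indicator:
  assumes x: "x \<in> D"
  shows "admissible (\<lambda>t. indicator {0..<x} t)"
proof -
  have [measurable]: "{0..<x} \<in> sets (lebesgue_on D)"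
    using x by (rule Ico_sets)
  have sub: "{0..<x} \<subseteq> D"
    using x D_down by auto
  show ?thesis
  proof (cases "p = \<infinity>")
    case True
    have "emeasure (lebesgue_on D) {0..<x} < \<infinity>"
      using D_lebesgue sub D_nonneg[OF x] by (simp add: emeasure_restrict_space)
    then have "integrable (lebesgue_on D) (\<lambda>t. indicator {0..<x} t :: real)"
      by (intro integrable_real_indicator) auto
    then show ?thesis
      using True unfolding admissible_def by auto
  next
    case False
    then have p: "p = 1" using p_cases by auto
    have "(\<lambda>t. \<psi> t powr -1) \<in> Lp_space \<infinity> (lebesgue_on {0..<x})"
      using condition p x by (auto simp: integrability_cond_def conj_index_def Lp_loc_def)
    from AE_bounded_if_esssup_finite[OF this]
    obtain C where "AE t in lebesgue_on {0..<x}. \<bar>\<psi> t powr -1\<bar> \<le> C"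
      by blast
    then have "AE t in lebesgue. t \<in> {0..<x} \<longrightarrow> \<bar>\<psi> t powr -1\<bar> \<le> C"
      by (subst (asm) AE_restrict_space_iff) auto
    then have "AE t in lebesgue_on D. t \<in> {0..<x} \<longrightarrow> \<bar>\<psi> t powr -1\<bar> \<le> C"
      using D_lebesgue by (subst AE_restrict_space_iff) auto
    with \<psi>_facts(2) have "AE t in lebesgue_on D. \<bar>indicator {0..<x} t\<bar> \<le> \<bar>C\<bar> * \<psi> t"
    proof eventually_elim
      case (elim t)
      show ?case
      proof (cases "t \<in> {0..<x}")
        case True
        then have "\<psi> t powr -1 \<le> \<bar>C\<bar>" using elim by auto
        then show ?thesis
          using True elim by (simp add: powr_minus_divide field_simps)
      qed (use elim in simp)
    qed
    with False show ?thesis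
      unfolding admissible_def by auto
  qed
qed

section \<open>Functions with vanishing integrals over boxes\<close>

lemma coord_measurable: "i \<in> u \<Longrightarrow> (\<lambda>t. t i) \<in> borel_measurable (prod_M u)"
  by (rule measurable_compose[OF measurable_component_singleton[of i u "\<lambda>_. lebesgue_on D"] id_measurable])

text \<open>A Lebesgue set is a Borel set up to a null set. This bridges the completed measure on
  \<open>D\<close> and the uniqueness lemma for measures on the Borel sets.\<close>

lemma lebesgue_on_AE_borel:
  assumes "A \<in> sets (lebesgue_on D)"
  obtains B where "B \<in> sets borel" "AE t in lebesgue_on D. t \<in> A \<longleftrightarrow> t \<in> B"
proof -
  have "A \<in> sets lebesgue" and "A \<subseteq> D"
    using assms D_lebesgue by (auto simp: sets_restrict_space_iff)
  then obtain S Z Z' where *: "A = S \<union> Z" "Z \<subseteq> Z'" "Z' \<in> null_sets lborel" "S \<in> sets lborel"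
    by (auto elim: sets_completionE)
  then have "AE t in lborel. t \<notin> Z'"
    by (auto intro: AE_not_in)
  then have "AE t in lebesgue. t \<notin> Z'"
    by (rule AE_completion)
  then have "AE t in lebesgue_on D. t \<notin> Z'"
    using D_lebesgue by (subst AE_restrict_space_iff) auto
  then have "AE t in lebesgue_on D. t \<in> A \<longleftrightarrow> t \<in> S"
    by eventually_elim (use * in auto)
  then show ?thesis
    using * by (intro that) auto
qed

lemma uminus_vimage_borel: "B \<in> sets borel \<Longrightarrow> uminus -` B \<in> sets (borel :: real measure)"
  using measurable_sets[of uminus "borel :: real measure" borel B] by simp

text \<open>The reflected coordinate is used because half-lines unbounded above generate the Borel
  sets in the uniqueness lemma \<open>measure_eqI_lessThan\<close>.\<close>

lemma integral_coordinate_zero: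
  fixes k :: "(nat \<Rightarrow> real) \<Rightarrow> real"
  assumes k: "integrable (prod_M u) k" and i: "i \<in> u" "finite u"
    and zero: "\<And>x. (LINT t|prod_M u. k t * indicator {..<x} (t i)) = 0"
    and A: "A \<in> sets (lebesgue_on D)"
  shows "(LINT t|prod_M u. k t * indicator A (t i)) = 0"
proof -
  note [measurable] = coord_measurable[OF i(1)] borel_measurable_integrable[OF k]
  \<comment> \<open>By the truncation in \<open>ennreal\<close>, \<mu> k and \<mu> (- k) are the
    laws of - t i under the positive and the negative part of k. The claim for Borel sets is their
    equality.\<close>
  define \<mu> where "\<mu> f = distr (density (prod_M u) (\<lambda>t. ennreal (f t))) borel (\<lambda>t. - t i)"
    for f :: "_ \<Rightarrow> real"
  have int: "integrable (prod_M u) (\<lambda>t. k t * indicator B (t i))" if [measurable]: "B \<in> sets borel" for B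
    by (rule Bochner_Integration.integrable_bound[OF k]) (auto simp: indicator_def)
  have \<mu>: "emeasure (\<mu> f) B = (\<integral>\<^sup>+t. ennreal (f t * indicator (uminus -` B) (t i)) \<partial>prod_M u)"
    if [measurable]: "B \<in> sets borel" "f \<in> borel_measurable (prod_M u)" for f B
  proof -
    have "emeasure (\<mu> f) B = (\<integral>\<^sup>+t. ennreal (f t) * indicator ((\<lambda>t. - t i) -` B \<inter> space (prod_M u)) t \<partial>prod_M u)"
      unfolding \<mu>_def by (subst emeasure_distr) (auto intro!: emeasure_density)
    also have "\<dots> = (\<integral>\<^sup>+t. ennreal (f t * indicator (uminus -` B) (t i)) \<partial>prod_M u)"
      by (intro nn_integral_cong) (auto simp: indicator_def)
    finally show ?thesis .
  qed
  have \<mu>_iff: "emeasure (\<mu> k) B = emeasure (\<mu> (\<lambda>t. - k t)) B \<longleftrightarrow>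
      (LINT t|prod_M u. k t * indicator (uminus -` B) (t i)) = 0" if [measurable]: "B \<in> sets borel" for B
  proof -
    note [measurable] = uminus_vimage_borel[OF that]
    show ?thesis
      by (subst integral_eq_0_iff_nn_integral[OF int]) (auto simp: \<mu>)
  qed
  have "\<mu> k = \<mu> (\<lambda>t. - k t)"
  proof (rule measure_eqI_lessThan)
    fix x :: real
    have "uminus -` {x<..} = {..<-x}" by auto
    then show "emeasure (\<mu> k) {x<..} = emeasure (\<mu> (\<lambda>t. - k t)) {x<..}"
      using zero[of "- x"] by (simp add: \<mu>_iff)
    have "emeasure (\<mu> k) {x<..} = (\<integral>\<^sup>+t. ennreal (k t * indicator {..<-x} (t i)) \<partial>prod_M u)"
      using \<open>uminus -` {x<..} = {..<-x}\<close> by (subst \<mu>) auto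
    also have "\<dots> < \<infinity>"
      using int[of "{..<-x}"] by (simp add: real_integrable_def less_top)
    finally show "emeasure (\<mu> k) {x<..} < \<infinity>" .
  qed (auto simp: \<mu>_def)
  then have borel0: "(LINT t|prod_M u. k t * indicator (uminus -` B) (t i)) = 0" if "B \<in> sets borel" for B
    using \<mu>_iff[OF that] by simp
  obtain B where B: "B \<in> sets borel" "AE t in lebesgue_on D. t \<in> A \<longleftrightarrow> t \<in> B"
    using lebesgue_on_AE_borel[OF A] .
  have [measurable]: "(\<lambda>t. indicator A (t i) :: real) \<in> borel_measurable (prod_M u)"
    using A i by (intro measurable_compose[OF measurable_component_singleton]) auto
  note [measurable] = B(1)
  have "AE t in prod_M u. t i \<in> A \<longleftrightarrow> t i \<in> B"
    using i B by (intro AE_prod_component)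
  then have "(LINT t|prod_M u. k t * indicator A (t i)) = (LINT t|prod_M u. k t * indicator B (t i))"
  proof (intro integral_cong_AE)
    show "AE t in prod_M u. k t * indicator A (t i) = k t * indicator B (t i)"
      using \<open>AE t in prod_M u. t i \<in> A \<longleftrightarrow> t i \<in> B\<close>
      by eventually_elim (simp add: indicator_def)
  qed measurable
  also have "\<dots> = 0"
    using borel0[OF uminus_vimage_borel[OF B(1)]] by (simp add: vimage_def)
  finally show ?thesis .
qed

text \<open>Intervals starting at 0 are replaced by arbitrary measurable sides one coordinate at a
  time: \<open>J\<close> collects the coordinates already treated. The fixed outer box given by
  \<open>X\<close> keeps every integrand integrable.\<close>

lemma integral_box_zero:
  assumes u: "finite u" and h: "h \<in> L u"
    and zero: "\<And>x. (\<And>j. j \<in> u \<Longrightarrow> x j \<in> D) \<Longrightarrow>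
      (LINT t|prod_M u. h t * (\<Prod>j\<in>u. indicator {0..<x j} (t j))) = 0"
    and X: "\<And>j. j \<in> u \<Longrightarrow> X j \<in> D"
    and J: "J \<subseteq> u"
    and A: "\<And>j. j \<in> J \<Longrightarrow> A j \<in> sets (lebesgue_on D) \<and> A j \<subseteq> {0..<X j}"
      "\<And>j. j \<in> u - J \<Longrightarrow> \<exists>x\<in>D. x \<le> X j \<and> A j = {0..<x}"
  shows "(LINT t|prod_M u. h t * (\<Prod>j\<in>u. indicator (A j) (t j))) = 0"
  using finite_subset[OF J u] J A
proof (induction J arbitrary: A rule: finite_induct)
  case empty
  then have "\<forall>j\<in>u. \<exists>x. x \<in> D \<and> A j = {0..<x}" by auto
  then obtain x where "\<And>j. j \<in> u \<Longrightarrow> x j \<in> D \<and> A j = {0..<x j}" by metis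
  then show ?case
    using zero[of x] by simp
next
  case (insert i J)
  have i: "i \<in> u" using insert by auto
  define A' where "A' B = A(i := B)" for B
  have split: "(\<Prod>j\<in>u. indicator (A' B j) (t j) :: real)
      = indicator B (t i) * (\<Prod>j\<in>u - {i}. indicator (A j) (t j))" for B t
    using i u by (subst prod.remove[of _ i]) (auto simp: A'_def intro!: prod.cong)
  \<comment> \<open>In coordinate \<open>i\<close> the full side {0..<X i} is taken, so that one
    more indicator in that coordinate produces either a shorter interval or the wanted set
    \<open>A i\<close>.\<close>
  define k where "k t = h t * (\<Prod>j\<in>u. indicator (A' {0..<X i} j) (t j))" for t
  have A'_sub: "A' {0..<X i} j \<in> sets (lebesgue_on D) \<and> A' {0..<X i} j \<subseteq> {0..<X j}" if "j \<in> u" for j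
  proof (cases "j \<in> insert i J")
    case True
    then show ?thesis
      using insert.prems(2)[of j] X[OF i] Ico_sets by (auto simp: A'_def)
  next
    case False
    then obtain x where "x \<in> D" "x \<le> X j" "A j = {0..<x}"
      using insert.prems(3)[of j] \<open>j \<in> u\<close> by auto
    then show ?thesis
      using False Ico_sets by (auto simp: A'_def)
  qed
  have "integrable (prod_M u) k"
    unfolding k_def
  proof (rule integrable_admissible[OF u h])
    fix j assume j: "j \<in> u"
    show "admissible (indicator (A' {0..<X i} j))"
      by (rule admissible_bounded_by[OF admissible_indicator[OF X[OF j]]])
        (use A'_sub[OF j] in \<open>auto simp: indicator_def\<close>)
  qed
  moreover have "(LINT t|prod_M u. k t * indicator {..<x} (t i)) = 0" for x
  proof -
    \<comment> \<open>On {0..} the half-line {..<x} cuts {0..<X i} down to {0..<y}. Clipping to the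
      range from 0 to \<open>X i\<close> keeps \<open>y\<close> in \<open>D\<close>, and the
      induction hypothesis covers this side.\<close>
    define y where "y = max 0 (min x (X i))"
    have "0 \<le> X i" using X[OF i] D_nonneg by simp
    then have y: "y \<in> D" "y \<le> X i"
      using D_down[OF X[OF i]] by (auto simp: y_def)
    have "k t * indicator {..<x} (t i) = h t * (\<Prod>j\<in>u. indicator (A' {0..<y} j) (t j))"
      if "t \<in> space (prod_M u)" for t
    proof -
      have "0 \<le> t i" using that i D_nonneg by (auto simp: space_PiM)
      then have "indicator {0..<X i} (t i) * indicator {..<x} (t i) = (indicator {0..<y} (t i) :: real)"
        by (auto simp: indicator_def y_def)
      then show ?thesis
        by (simp add: k_def split mult_ac)
    qed
    then have "(LINT t|prod_M u. k t * indicator {..<x} (t i))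
        = (LINT t|prod_M u. h t * (\<Prod>j\<in>u. indicator (A' {0..<y} j) (t j)))"
      by (intro Bochner_Integration.integral_cong) auto
    also have "\<dots> = 0"
    proof (rule insert.IH)
      show "A' {0..<y} j \<in> sets (lebesgue_on D) \<and> A' {0..<y} j \<subseteq> {0..<X j}" if "j \<in> J" for j
        using that insert.prems(2)[of j] insert.hyps by (auto simp: A'_def)
      show "\<exists>x\<in>D. x \<le> X j \<and> A' {0..<y} j = {0..<x}" if "j \<in> u - J" for j
        using that insert.prems(3)[of j] y by (cases "j = i") (auto simp: A'_def)
    qed (use insert.prems in auto)
    finally show ?thesis .
  qed
  ultimately have "(LINT t|prod_M u. k t * indicator (A i) (t i)) = 0"
    by (rule integral_coordinate_zero[OF _ i u])
      (use insert.prems(2)[of i] in blast)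
  moreover have "k t * indicator (A i) (t i) = h t * (\<Prod>j\<in>u. indicator (A j) (t j))" for t
  proof -
    have "indicator {0..<X i} (t i) * indicator (A i) (t i) = (indicator (A i) (t i) :: real)"
      using insert.prems(2)[of i] by (auto simp: indicator_def)
    moreover have "A' (A i) = A"
      by (simp add: A'_def)
    ultimately show ?thesis
      using split[of "A i" t] by (auto simp: k_def split)
  qed
  ultimately show ?case by simp
qed

text \<open>When D = {0..T}, no interval {0..<x} with x in D contains T, so exhaustion holds only
  almost everywhere; the constant sequence T then suffices.\<close>

lemma D_exhaust:
  "\<exists>x :: nat \<Rightarrow> real. (\<forall>n. x n \<in> D) \<and> incseq x \<and> (AE t in lebesgue_on D. \<exists>n. t < x n)"
proof -
  consider "D = {0..}" | T where "T > 0" "D = {0..<T}" | T where "T > 0" "D = {0..T}"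
    using domain by (auto simp: is_domain_def)
  then show ?thesis
  proof cases
    case 1
    show ?thesis
    proof (intro exI[of _ real] conjI)
      show "AE t in lebesgue_on D. \<exists>n. t < real n"
        by (auto intro!: AE_I2 reals_Archimedean2)
    qed (auto simp: 1 incseq_def)
  next
    case 2
    have lim: "(\<lambda>n. T * (1 - 1 / real (Suc n))) \<longlonglongrightarrow> T * (1 - 0)"
      by (intro tendsto_intros LIMSEQ_Suc[OF lim_1_over_n])
    show ?thesis
    proof (intro exI[of _ "\<lambda>n. T * (1 - 1 / real (Suc n))"] conjI allI)
      show "incseq (\<lambda>n. T * (1 - 1 / real (Suc n)))"
        using 2 by (intro incseq_SucI mult_left_mono) (auto simp: field_simps)
      show "AE t in lebesgue_on D. \<exists>n. t < T * (1 - 1 / real (Suc n))"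
      proof (rule AE_I2)
        fix t assume "t \<in> space (lebesgue_on D)"
        then have "t < T * (1 - 0)" using 2 by simp
        from order_tendstoD(1)[OF lim this] show "\<exists>n. t < T * (1 - 1 / real (Suc n))"
          by (auto simp: eventually_sequentially)
      qed
      show "T * (1 - 1 / real (Suc n)) \<in> D" for n
        using 2 by (auto simp: field_simps)
    qed
  next
    case 3
    have "AE t in lebesgue. t \<noteq> T"
      by (intro AE_completion AE_lborel_singleton)
    then have "AE t in lebesgue_on D. t \<noteq> T"
      using D_lebesgue by (subst AE_restrict_space_iff) auto
    then have "AE t in lebesgue_on D. t < T"
      by (rule lebesgue_on_mono) (use 3 in auto)
    then show ?thesis
      using 3 by (intro exI[of _ "\<lambda>_. T"]) auto
  qed
qed

text \<open>Cut off to a box, the component is integrable. Its positive and negative parts are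
  densities of finite measures that agree on all measurable boxes, hence everywhere, and densities
  are unique almost everywhere.\<close>

lemma AE_zero_on_box:
  assumes u: "finite u" and h: "h \<in> L u"
    and zero: "\<And>x. (\<And>j. j \<in> u \<Longrightarrow> x j \<in> D) \<Longrightarrow>
      (LINT t|prod_M u. h t * (\<Prod>j\<in>u. indicator {0..<x j} (t j))) = 0"
    and X: "\<And>j. j \<in> u \<Longrightarrow> X j \<in> D"
  shows "AE t in prod_M u. h t * (\<Prod>j\<in>u. indicator {0..<X j} (t j)) = 0"
proof -
  define k where "k t = h t * (\<Prod>j\<in>u. indicator {0..<X j} (t j))" for t
  have k: "integrable (prod_M u) k"
    unfolding k_def by (intro integrable_admissible u h admissible_indicator X)
  note [measurable] = borel_measurable_integrable[OF k]
  define \<nu> where "\<nu> f = density (prod_M u) (\<lambda>t. ennreal (f t))" for f :: "_ \<Rightarrow> real"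
  have "\<nu> k = \<nu> (\<lambda>t. - k t)"
  proof (rule measure_eqI_PiM_finite[OF u])
    fix A assume A: "\<And>i. i \<in> u \<Longrightarrow> A i \<in> sets (lebesgue_on D)"
    then have PA: "PiE u A \<in> sets (prod_M u)"
      using u by (intro sets_PiM_I_finite) auto
    have \<nu>: "emeasure (\<nu> f) (PiE u A) = (\<integral>\<^sup>+t. ennreal (f t * (\<Prod>j\<in>u. indicator (A j) (t j))) \<partial>prod_M u)"
      if [measurable]: "f \<in> borel_measurable (prod_M u)" for f
    proof -
      have "emeasure (\<nu> f) (PiE u A) = (\<integral>\<^sup>+t. ennreal (f t) * indicator (PiE u A) t \<partial>prod_M u)"
        unfolding \<nu>_def by (intro emeasure_density PA) auto
      also have "\<dots> = (\<integral>\<^sup>+t. ennreal (f t * (\<Prod>j\<in>u. indicator (A j) (t j))) \<partial>prod_M u)"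
      proof (intro nn_integral_cong)
        fix t assume t: "t \<in> space (prod_M u)"
        have "(\<Prod>j\<in>u. indicator (A j) (t j)) = (indicator (PiE u A) t :: real)"
        proof (cases "t \<in> PiE u A")
          case False
          then obtain j where "j \<in> u" "t j \<notin> A j"
            using t by (auto simp: space_PiM PiE_iff)
          then have "(\<Prod>j\<in>u. indicator (A j) (t j) :: real) = 0"
            using u by (intro prod_zero) (auto intro!: bexI[of _ j])
          then show ?thesis
            using False by simp
        qed (auto simp: PiE_iff)
        then show "ennreal (f t) * indicator (PiE u A) t = ennreal (f t * (\<Prod>j\<in>u. indicator (A j) (t j)))"
          by (simp add: indicator_def)
      qed
      finally show ?thesis .
    qed
    have eq: "k t * (\<Prod>j\<in>u. indicator (A j) (t j)) = h t * (\<Prod>j\<in>u. indicator (A j \<inter> {0..<X j}) (t j))" for t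
      by (simp add: k_def indicator_inter_arith prod.distrib mult_ac)
    have "integrable (prod_M u) (\<lambda>t. k t * (\<Prod>j\<in>u. indicator (A j) (t j)))"
      unfolding eq
    proof (rule integrable_admissible[OF u h])
      fix j assume j: "j \<in> u"
      show "admissible (indicator (A j \<inter> {0..<X j}))"
        by (rule admissible_bounded_by[OF admissible_indicator[OF X[OF j]]])
          (use A[OF j] Ico_sets[OF X[OF j]] in \<open>auto simp: indicator_def\<close>)
    qed
    moreover have "(LINT t|prod_M u. k t * (\<Prod>j\<in>u. indicator (A j) (t j))) = 0"
      unfolding eq
      by (rule integral_box_zero[OF u h zero X order.refl])
        (use A Ico_sets[OF X] in auto)
    ultimately show "emeasure (\<nu> k) (PiE u A) = emeasure (\<nu> (\<lambda>t. - k t)) (PiE u A)"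
      by (subst (asm) integral_eq_0_iff_nn_integral) (auto simp: \<nu>)
  next
    \<comment> \<open>Both measures are finite, so the constant sequence of the whole space serves
      as exhausting sequence.\<close>
    show "range (\<lambda>_::nat. space (prod_M u)) \<subseteq> prod_algebra u (\<lambda>_. lebesgue_on D)"
      using prod_algebraI_finite[OF u, of "\<lambda>_. D" "\<lambda>_. lebesgue_on D"] by (auto simp: space_PiM)
    show "emeasure (\<nu> k) (space (prod_M u)) \<noteq> \<infinity>"
      using k by (simp add: \<nu>_def emeasure_density real_integrable_def cong: nn_integral_cong)
  qed (auto simp: \<nu>_def)
  interpret prod: sigma_finite_measure "prod_M u"
    using u by (rule sigma_finite)
  have "AE t in prod_M u. ennreal (k t) = ennreal (- k t)"
    using \<open>\<nu> k = \<nu> (\<lambda>t. - k t)\<close> unfolding \<nu>_def by (subst (asm) prod.density_unique_iff) auto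
  \<comment> \<open>One of \<open>ennreal (k t)\<close> and \<open>ennreal (- k t)\<close> is always
    0, so equality forces both to be 0.\<close>
  then have "AE t in prod_M u. k t = 0"
  proof eventually_elim
    case (elim t)
    then show ?case
      by (cases "k t" "0 :: real" rule: linorder_cases) (auto simp: ennreal_neg ennreal_eq_0_iff)
  qed
  then show ?thesis by (simp add: k_def)
qed

text \<open>Countably many boxes share one exceptional null set, and almost every point lies in one
  of them.\<close>

lemma AE_zero_if_box_integrals_zero:
  assumes u: "finite u" and h: "h \<in> L u"
    and zero: "\<And>x. (\<And>j. j \<in> u \<Longrightarrow> x j \<in> D) \<Longrightarrow>
      (LINT t|prod_M u. h t * (\<Prod>j\<in>u. indicator {0..<x j} (t j))) = 0"
  shows "AE t in prod_M u. h t = 0"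
proof -
  obtain x :: "nat \<Rightarrow> real" where x: "\<And>n. x n \<in> D" "incseq x" "AE t in lebesgue_on D. \<exists>n. t < x n"
    using D_exhaust by blast
  have "AE t in prod_M u. \<forall>n. h t * (\<Prod>j\<in>u. indicator {0..<x n} (t j)) = 0"
    using AE_zero_on_box[OF u h zero] x(1) by (subst AE_all_countable) auto
  moreover have "AE t in prod_M u. \<forall>j\<in>u. \<exists>n. t j < x n"
    using u x(3) by (intro AE_prod_all)
  ultimately have "AE t in prod_M u. t \<in> space (prod_M u) \<and> (\<forall>j\<in>u. \<exists>n. t j < x n) \<and>
      (\<forall>n. h t * (\<Prod>j\<in>u. indicator {0..<x n} (t j)) = 0)"
    by auto
  then show ?thesis
  proof eventually_elim
    case (elim t)
    then obtain n where n: "\<And>j. j \<in> u \<Longrightarrow> t j < x (n j)" by metis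
    \<comment> \<open>Inserting 0 keeps the maximum defined when \<open>u\<close> is empty.\<close>
    define m where "m = Max (insert 0 (n ` u))"
    have "indicator {0..<x m} (t j) = (1 :: real)" if "j \<in> u" for j
    proof -
      have "n j \<le> m" using that u by (auto simp: m_def)
      then have "t j < x m" using n[OF that] x(2) by (meson incseqD less_le_trans)
      moreover have "0 \<le> t j" using elim that D_nonneg by (auto simp: space_PiM)
      ultimately show ?thesis by simp
    qed
    then have "(\<Prod>j\<in>u. indicator {0..<x m} (t j)) = (1 :: real)" by simp
    with elim show ?case by (metis mult.right_neutral)
  qed
qed

end

section \<open>Anchored and ANOVA components\<close>

fun dual :: "space_kind \<Rightarrow> space_kind" where
  "dual Anchored = ANOVA"
| "dual ANOVA = Anchored"

text \<open>The sign in front of the tail integral when the kernel of this kind is expressed by the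
  other kernel.\<close>

fun sgn_kind :: "space_kind \<Rightarrow> real" where
  "sgn_kind Anchored = 1"
| "sgn_kind ANOVA = -1"

lemma sgn_kind_sq: "sgn_kind k ^ n * sgn_kind k ^ n = 1"
  by (cases k) (simp_all flip: power_mult_distrib)

lemma abs_sgn_kind_power [simp]: "\<bar>sgn_kind k ^ n\<bar> = 1"
  by (cases k) (simp_all add: power_abs)

lemma kernel_dual: "kernel k D \<psi> x t = kernel (dual k) D \<psi> x t + sgn_kind k * psibar D \<psi> t"
  by (cases k) auto

lemma lq_norm_cong: "(\<And>i. i \<in> U \<Longrightarrow> a i = a' i) \<Longrightarrow> lq_norm q U a = lq_norm q U a'"
  by (simp add: lq_norm_def cong: image_cong_simp sum.cong)

locale anova_setting = density_domain +
  fixes d :: nat and \<gamma> :: "nat set \<Rightarrow> real"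
  assumes \<gamma>_nonneg: "u \<subseteq> {1..d} \<Longrightarrow> 0 \<le> \<gamma> u"
    and \<gamma>_nonzero: "\<exists>u \<subseteq> {1..d}. \<gamma> u \<noteq> 0"
    and \<gamma>_down: "w \<subseteq> {1..d} \<Longrightarrow> 0 < \<gamma> w \<Longrightarrow> u \<subseteq> w \<Longrightarrow> 0 < \<gamma> u"
begin

abbreviation S :: "nat set set" where "S \<equiv> supp_weights d \<gamma>"

abbreviation Dd :: "(nat \<Rightarrow> real) set" where "Dd \<equiv> \<Pi>\<^sub>E j\<in>{1..d}. D"

abbreviation T :: "space_kind \<Rightarrow> nat set \<Rightarrow> ((nat \<Rightarrow> real) \<Rightarrow> real) \<Rightarrow> (nat \<Rightarrow> real) \<Rightarrow> real" where
  "T k u g \<equiv> T_op k d D \<psi> u g"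

abbreviation rep :: "space_kind \<Rightarrow> (nat set \<Rightarrow> (nat \<Rightarrow> real) \<Rightarrow> real) \<Rightarrow> ((nat \<Rightarrow> real) \<Rightarrow> real) \<Rightarrow> bool" where
  "rep k g f \<equiv> represents k d D \<psi> p \<gamma> g f"

abbreviation b :: "real \<Rightarrow> real" where "b \<equiv> psibar D \<psi>"

lemma finite_S: "finite S"
  by (rule finite_subset[of _ "Pow {1..d}"]) (auto simp: supp_weights_def)

lemma S_subset: "u \<in> S \<Longrightarrow> u \<subseteq> {1..d}"
  by (simp add: supp_weights_def)

lemma S_finite: "u \<in> S \<Longrightarrow> finite u"
  using S_subset finite_subset by blast

lemma S_pos: "u \<in> S \<Longrightarrow> 0 < \<gamma> u"
  by (simp add: supp_weights_def)

lemma S_down: "w \<in> S \<Longrightarrow> u \<subseteq> w \<Longrightarrow> u \<in> S"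
  using \<gamma>_down by (auto simp: supp_weights_def)

lemma empty_in_S: "{} \<in> S"
proof -
  obtain u where "u \<subseteq> {1..d}" "\<gamma> u \<noteq> 0"
    using \<gamma>_nonzero by auto
  then have "u \<in> S"
    using \<gamma>_nonneg[of u] by (simp add: supp_weights_def)
  then show ?thesis
    by (rule S_down) simp
qed

lemma weighted_prod_eq: "weighted_prod D \<psi> u = prod_W u"
  by (simp add: weighted_prod_def)

lemma rep_L: "rep k g f \<Longrightarrow> u \<in> S \<Longrightarrow> g u \<in> L u"
  by (simp add: represents_def weighted_prod_eq)

lemma rep_eval: "rep k g f \<Longrightarrow> x \<in> Dd \<Longrightarrow> f x = (\<Sum>u\<in>S. T k u (g u) x)"
  by (simp add: represents_def)

lemma repI:
  assumes "\<And>u. u \<in> S \<Longrightarrow> g u \<in> L u"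
    and "f \<in> extensional Dd" "\<And>x. x \<in> Dd \<Longrightarrow> f x = (\<Sum>u\<in>S. T k u (g u) x)"
  shows "rep k g f"
proof -
  have "f = (\<lambda>x \<in> Dd. \<Sum>u\<in>S. T k u (g u) x)"
    by (rule extensionalityI[of _ Dd]) (use assms in auto)
  then show ?thesis
    using assms(1) by (simp add: represents_def weighted_prod_eq)
qed

lemma rep_extensional: "rep k g f \<Longrightarrow> f \<in> extensional Dd"
  by (simp add: represents_def)

lemma T_eval: "x \<in> Dd \<Longrightarrow> T k u g x = (LINT t|prod_M u. g t * (\<Prod>j\<in>u. kernel k D \<psi> (x j) (t j)))"
  by (simp add: T_op_def)

lemma admissible_kernel: "x \<in> D \<Longrightarrow> admissible (kernel k D \<psi> x)"
proof (cases k)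
  case Anchored
  moreover have "kernel Anchored D \<psi> x = (\<lambda>t. indicator {0..<x} t)" by (rule ext) simp
  ultimately show "x \<in> D \<Longrightarrow> ?thesis" by (simp add: admissible_indicator)
next
  case ANOVA
  moreover have "kernel ANOVA D \<psi> x = (\<lambda>t. indicator {0..<x} t - b t)" by (rule ext) simp
  ultimately show "x \<in> D \<Longrightarrow> ?thesis"
    by (simp add: admissible_indicator admissible_b admissible_diff)
qed

lemma T_sum:
  assumes u: "finite u" "u \<subseteq> {1..d}" and x: "x \<in> Dd" and V: "finite V"
    and g: "\<And>w. w \<in> V \<Longrightarrow> g w \<in> L u"
  shows "T k u (\<lambda>t. \<Sum>w\<in>V. r w * g w t) x = (\<Sum>w\<in>V. r w * T k u (g w) x)"
proof -
  have "integrable (prod_M u) (\<lambda>t. g w t * (\<Prod>j\<in>u. kernel k D \<psi> (x j) (t j)))" if "w \<in> V" for w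
    using u x that by (intro integrable_admissible g admissible_kernel) auto
  then have "(LINT t|prod_M u. (\<Sum>w\<in>V. r w * (g w t * (\<Prod>j\<in>u. kernel k D \<psi> (x j) (t j)))))
      = (\<Sum>w\<in>V. LINT t|prod_M u. r w * (g w t * (\<Prod>j\<in>u. kernel k D \<psi> (x j) (t j))))"
    by (intro Bochner_Integration.integral_sum integrable_mult_right)
  then show ?thesis
    using x by (simp add: T_eval sum_distrib_right mult.assoc)
qed

lemma T_dual:
  assumes w: "finite w" "w \<subseteq> {1..d}" and x: "x \<in> Dd" and g: "g \<in> L w"
  shows "T k w g x = (\<Sum>u\<in>Pow w. sgn_kind k ^ card (w - u) * T (dual k) u (P w u g) x)"
proof -
  let ?K = "\<lambda>j. kernel (dual k) D \<psi> (x j)"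
  let ?F = "\<lambda>u t. g t * ((\<Prod>j\<in>u. ?K j (t j)) * (\<Prod>j\<in>w - u. b (t j)))"
  have adm: "admissible (?K j)" if "j \<in> u" "u \<subseteq> w" for j u
    using that w x by (intro admissible_kernel) auto
  \<comment> \<open>In the expanded product, \<open>u\<close> is the set of coordinates at which the
    other kernel is chosen; the remaining ones contribute the signed tail integral.\<close>
  have "g t * (\<Prod>j\<in>w. kernel k D \<psi> (x j) (t j)) = (\<Sum>u\<in>Pow w. sgn_kind k ^ card (w - u) * ?F u t)" for t
    unfolding kernel_dual[of k] using w(1)
    by (subst prod_add) (simp_all add: prod.distrib sum_distrib_left mult_ac)
  then have "T k w g x = (LINT t|prod_M w. (\<Sum>u\<in>Pow w. sgn_kind k ^ card (w - u) * ?F u t))"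
    using x by (simp only: T_eval)
  also have "\<dots> = (\<Sum>u\<in>Pow w. LINT t|prod_M w. sgn_kind k ^ card (w - u) * ?F u t)"
    using P_Fubini(2)[OF w(1) _ g, of _ ?K] adm
    by (intro Bochner_Integration.integral_sum integrable_mult_right) auto
  also have "\<dots> = (\<Sum>u\<in>Pow w. sgn_kind k ^ card (w - u) * T (dual k) u (P w u g) x)"
  proof (rule sum.cong[OF refl])
    fix u assume "u \<in> Pow w"
    then have u: "u \<subseteq> w" by simp
    have "(LINT t|prod_M w. ?F u t) = T (dual k) u (P w u g) x"
      using P_Fubini(3)[OF w(1) u g, of ?K] adm u x by (simp add: T_eval)
    then show "(LINT t|prod_M w. sgn_kind k ^ card (w - u) * ?F u t)
        = sgn_kind k ^ card (w - u) * T (dual k) u (P w u g) x"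
      by simp
  qed
  finally show ?thesis .
qed

text \<open>The components with respect to the kernel of kind \<open>dual k\<close> of the function
  whose components with respect to kind \<open>k\<close> are \<open>g\<close>.\<close>

definition change :: "space_kind \<Rightarrow> (nat set \<Rightarrow> (nat \<Rightarrow> real) \<Rightarrow> real) \<Rightarrow> nat set \<Rightarrow> (nat \<Rightarrow> real) \<Rightarrow> real" where
  "change k g u t = (\<Sum>w\<in>{w\<in>S. u \<subseteq> w}. sgn_kind k ^ card (w - u) * P w u (g w) t)"

lemma change_bound:
  assumes g: "\<And>w. w \<in> S \<Longrightarrow> g w \<in> L w" and u: "u \<in> S"
  shows "change k g u \<in> L u"
    and "N u (change k g u) \<le> (\<Sum>w\<in>{w\<in>S. u \<subseteq> w}. c ^ card (w - u) * N w (g w))"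
proof -
  let ?V = "{w\<in>S. u \<subseteq> w}"
  have V: "finite ?V" using finite_S by auto
  have P: "P w u (g w) \<in> L u" "N u (P w u (g w)) \<le> c ^ card (w - u) * N w (g w)" if "w \<in> ?V" for w
    using that P_norm[OF S_finite, of w u "g w"] g by auto
  have eq: "change k g u = (\<lambda>t. \<Sum>w\<in>?V. sgn_kind k ^ card (w - u) * P w u (g w) t)"
    by (rule ext) (simp add: change_def)
  show "change k g u \<in> L u"
    unfolding eq using P by (intro L_sum S_finite u V) auto
  have "N u (change k g u) \<le> (\<Sum>w\<in>?V. \<bar>sgn_kind k ^ card (w - u)\<bar> * N u (P w u (g w)))"
    unfolding eq using P by (intro L_sum S_finite u V) auto
  also have "\<dots> \<le> (\<Sum>w\<in>?V. c ^ card (w - u) * N w (g w))"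
    using P by (intro sum_mono) auto
  finally show "N u (change k g u) \<le> (\<Sum>w\<in>?V. c ^ card (w - u) * N w (g w))" .
qed

text \<open>Each operator is expanded in operators of the other kind indexed by the subsets of its
  index set. Downward closure of \<open>S\<close> keeps these subsets in \<open>S\<close>, so the
  double sum can be regrouped by the smaller set.\<close>

lemma rep_change:
  assumes "rep k g f"
  shows "rep (dual k) (change k g) f"
proof (rule repI)
  show "change k g u \<in> L u" if "u \<in> S" for u
    using change_bound(1)[OF rep_L[OF assms] that] .
  show "f \<in> extensional Dd"
    by (rule rep_extensional[OF assms])
  fix x assume x: "x \<in> Dd"
  have Pow: "Pow w = {u\<in>S. u \<subseteq> w}" if "w \<in> S" for w
    using S_down[OF that] by auto
  have "f x = (\<Sum>w\<in>S. \<Sum>u\<in>{u\<in>S. u \<subseteq> w}. sgn_kind k ^ card (w - u) * T (dual k) u (P w u (g w)) x)"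
    unfolding rep_eval[OF assms x]
    using T_dual[OF S_finite S_subset x rep_L[OF assms]] by (simp add: Pow)
  also have "\<dots> = (\<Sum>u\<in>S. \<Sum>w\<in>{w\<in>S. u \<subseteq> w}. sgn_kind k ^ card (w - u) * T (dual k) u (P w u (g w)) x)"
    by (rule sum.swap_restrict[OF finite_S finite_S])
  also have "\<dots> = (\<Sum>u\<in>S. T (dual k) u (change k g u) x)"
  proof (rule sum.cong[OF refl])
    fix u assume u: "u \<in> S"
    show "(\<Sum>w\<in>{w\<in>S. u \<subseteq> w}. sgn_kind k ^ card (w - u) * T (dual k) u (P w u (g w)) x)
        = T (dual k) u (change k g u) x"
      unfolding change_def[abs_def]
      using finite_S P_norm(1)[OF S_finite _ rep_L[OF assms]]
      by (intro T_sum[symmetric] S_finite S_subset u x) auto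
  qed
  finally show "f x = (\<Sum>u\<in>S. T (dual k) u (change k g u) x)" .
qed

lemma W_space_eq: "W_space ANOVA d D \<psi> p \<gamma> = W_space Anchored d D \<psi> p \<gamma>"
proof (rule set_eqI)
  fix f
  show "f \<in> W_space ANOVA d D \<psi> p \<gamma> \<longleftrightarrow> f \<in> W_space Anchored d D \<psi> p \<gamma>"
    using rep_change[of ANOVA _ f] rep_change[of Anchored _ f] unfolding W_space_def dual.simps by blast
qed

section \<open>Uniqueness of the components\<close>

lemma rep_diff:
  assumes g: "rep k g f" and h: "rep k h f"
  shows "rep k (\<lambda>u t. g u t - h u t) (\<lambda>x\<in>Dd. 0)"
proof (rule repI)
  \<comment> \<open>A difference is written as a sum over the two truth values with coefficients 1
    and -1, so that \<open>L_sum\<close> and \<open>T_sum\<close> cover it.\<close>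
  have eq: "(\<lambda>t. g u t - h u t) = (\<lambda>t. \<Sum>i\<in>UNIV. (if i then 1 else - 1) * (if i then g u else h u) t)" for u
    by (rule ext) (simp add: UNIV_bool)
  show "(\<lambda>t. g u t - h u t) \<in> L u" if "u \<in> S" for u
    unfolding eq using rep_L[OF g that] rep_L[OF h that] S_finite[OF that] by (intro L_sum) auto
  fix x assume x: "x \<in> Dd"
  have "T k u (\<lambda>t. g u t - h u t) x = T k u (g u) x - T k u (h u) x" if "u \<in> S" for u
    unfolding eq
    using rep_L[OF g that] rep_L[OF h that] S_finite[OF that] S_subset[OF that] x
    by (subst T_sum) (auto simp: UNIV_bool)
  then have "(\<Sum>u\<in>S. T k u (\<lambda>t. g u t - h u t) x) = f x - f x"
    using rep_eval[OF g x] rep_eval[OF h x] by (simp add: sum_subtractf)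
  then show "(\<lambda>x\<in>Dd. 0) x = (\<Sum>u\<in>S. T k u (\<lambda>t. g u t - h u t) x)"
    using x by simp
qed simp

text \<open>Setting the variables outside \<open>u\<close> to \<open>0\<close> annihilates every term not supported in \<open>u\<close>.\<close>

lemma anchored_T_zero:
  assumes h: "rep Anchored h (\<lambda>x\<in>Dd. 0)" and u: "u \<in> S" and x: "x \<in> Dd"
  shows "T Anchored u (h u) x = 0"
  using S_finite[OF u] u x
proof (induction u arbitrary: x rule: finite_psubset_induct)
  case (psubset u)
  define y where "y = (\<lambda>j\<in>{1..d}. if j \<in> u then x j else 0)"
  have y: "y \<in> Dd"
    using psubset.prems D_0 by (auto simp: y_def)
  \<comment> \<open>Proper subsets of \<open>u\<close> are handled by induction. Any other
    \<open>v\<close> contains a coordinate where \<open>y\<close> is 0, and there the anchored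
    kernel is the indicator of the empty interval {0..<0}.\<close>
  have "T Anchored v (h v) y = 0" if v: "v \<in> S" "v \<noteq> u" for v
  proof (cases "v \<subseteq> u")
    case True
    then show ?thesis using psubset.IH[of v y] v y by auto
  next
    case False
    then obtain j where j: "j \<in> v" "j \<notin> u" by auto
    then have "y j = 0" using S_subset[OF v(1)] by (auto simp: y_def)
    then have "(\<Prod>j\<in>v. kernel Anchored D \<psi> (y j) (t j)) = 0" for t
      using j S_finite[OF v(1)] by (intro prod_zero) (auto intro!: bexI[of _ j])
    then show ?thesis using y by (simp add: T_eval)
  qed
  then have "(\<Sum>v\<in>S. T Anchored v (h v) y) = T Anchored u (h u) y"
    using psubset.prems finite_S by (subst sum.remove[of _ u]) auto
  then have "T Anchored u (h u) y = 0"
    using rep_eval[OF h y] y by simp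
  moreover have "(\<Prod>j\<in>u. kernel Anchored D \<psi> (y j) (t j)) = (\<Prod>j\<in>u. kernel Anchored D \<psi> (x j) (t j))" for t
    using S_subset[OF psubset.prems(1)] by (intro prod.cong refl) (auto simp: y_def)
  ultimately show ?case
    using y psubset.prems by (simp only: T_eval)
qed

lemma anchored_AE_zero:
  assumes h: "rep Anchored h (\<lambda>x\<in>Dd. 0)" and u: "u \<in> S"
  shows "AE t in prod_M u. h u t = 0"
proof (rule AE_zero_if_box_integrals_zero[OF S_finite[OF u] rep_L[OF h u]])
  fix x :: "nat \<Rightarrow> real" assume x: "\<And>j. j \<in> u \<Longrightarrow> x j \<in> D"
  define y where "y = (\<lambda>j\<in>{1..d}. if j \<in> u then x j else 0)"
  have y: "y \<in> Dd"
    using x D_0 by (auto simp: y_def)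
  have "(\<Prod>j\<in>u. kernel Anchored D \<psi> (y j) (t j)) = (\<Prod>j\<in>u. indicator {0..<x j} (t j))" for t
    using S_subset[OF u] by (intro prod.cong refl) (auto simp: y_def)
  then show "(LINT t|prod_M u. h u t * (\<Prod>j\<in>u. indicator {0..<x j} (t j))) = 0"
    using anchored_T_zero[OF h u y] y by (simp only: T_eval)
qed

text \<open>The change of components is unitriangular with respect to inclusion, so vanishing
  components are recovered from the largest index sets downwards.\<close>

lemma rep_AE_zero:
  assumes h: "rep k h (\<lambda>x\<in>Dd. 0)" and u: "u \<in> S"
  shows "AE t in prod_M u. h u t = 0"
proof (cases k)
  case Anchored
  then show ?thesis using anchored_AE_zero assms by auto
next
  case ANOVA
  \<comment> \<open>The changed components are anchored components of the zero function, for which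
    uniqueness is known.\<close>
  have ch: "AE t in prod_M u. change k h u t = 0" if "u \<in> S" for u
    using anchored_AE_zero[of "change k h"] rep_change[OF h] ANOVA that by simp
  show ?thesis
    using u
  proof (induction "card ({1..d} - u)" arbitrary: u rule: less_induct)
    case less
    note u = less.prems
    let ?V = "{w\<in>S. u \<subseteq> w}"
    have zero: "AE t in prod_M u. P w u (h w) t = 0" if w: "w \<in> ?V - {u}" for w
    proof -
      have "card ({1..d} - w) < card ({1..d} - u)"
        using w S_subset[of w] by (intro psubset_card_mono) auto
      then show ?thesis
        using w S_finite[of w] less.hyps[of w] rep_L[OF h, of w] by (intro P_AE_zero) auto
    qed
    have "AE t in prod_M u. \<forall>w\<in>?V - {u}. P w u (h w) t = 0"
      using finite_S zero by (intro AE_finite_allI) auto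
    then have "AE t in prod_M u. t \<in> space (prod_M u) \<and> (\<forall>w\<in>?V - {u}. P w u (h w) t = 0)"
      by simp
    with ch[OF u] show ?case
    proof eventually_elim
      case (elim t)
      have "change k h u t = sgn_kind k ^ card (u - u) * P u u (h u) t
          + (\<Sum>w\<in>?V - {u}. sgn_kind k ^ card (w - u) * P w u (h w) t)"
        unfolding change_def using finite_S u by (intro sum.remove) auto
      also have "\<dots> = h u t"
        using elim by (simp add: P_self)
      finally show ?case using elim by simp
    qed
  qed
qed

text \<open>Two representations of \<open>f\<close> differ by a representation of 0, so their
  components agree a.e. and have equal norms. The definite description is then given by any
  representation.\<close>

lemma W_norm_eq:
  assumes g: "rep k g f"
  shows "W_norm k d D \<psi> p q \<gamma> f = lq_norm q S (\<lambda>u. N u (g u) / \<gamma> u)"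
  unfolding W_norm_def weighted_prod_eq
proof (rule the_equality)
  show "\<exists>g'. rep k g' f \<and> lq_norm q S (\<lambda>u. N u (g u) / \<gamma> u) = lq_norm q S (\<lambda>u. N u (g' u) / \<gamma> u)"
    using g by blast
  fix r assume "\<exists>h. rep k h f \<and> r = lq_norm q S (\<lambda>u. N u (h u) / \<gamma> u)"
  then obtain h where h: "rep k h f" and r: "r = lq_norm q S (\<lambda>u. N u (h u) / \<gamma> u)" by auto
  have "N u (h u) = N u (g u)" if u: "u \<in> S" for u
  proof (rule N_cong(2)[OF S_finite[OF u] rep_L[OF g u] L_measurable[OF rep_L[OF h u]]])
    show "AE t in prod_M u. g u t = h u t"
      using rep_AE_zero[OF rep_diff[OF g h] u] by eventually_elim simp
  qed
  then show "r = lq_norm q S (\<lambda>u. N u (g u) / \<gamma> u)"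
    unfolding r by (intro lq_norm_cong) simp
qed

section \<open>Operator norms\<close>

definition row :: "nat set \<Rightarrow> real \<Rightarrow> real" where
  "row u r = (\<Sum>w\<in>{w\<in>S. u \<subseteq> w}. r ^ card (w - u) * (\<gamma> w / \<gamma> u))"

definition col :: "nat set \<Rightarrow> real \<Rightarrow> real" where
  "col w r = (\<Sum>u\<in>Pow w. r ^ card (w - u) * (\<gamma> w / \<gamma> u))"

definition entry_sum :: "ereal \<Rightarrow> nat set \<Rightarrow> real \<Rightarrow> real" where
  "entry_sum q = (if q = \<infinity> then row else col)"

lemma \<gamma>_zero: "u \<subseteq> {1..d} \<Longrightarrow> u \<notin> S \<Longrightarrow> \<gamma> u = 0"
  using \<gamma>_nonneg[of u] by (auto simp: supp_weights_def)

text \<open>The substitution w = u \<union> v identifies the index sets; a set \<open>w\<close>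
  outside \<open>S\<close> contributes 0 because \<gamma> w = 0.\<close>

lemma row_eq:
  assumes u: "u \<subseteq> {1..d}"
  shows "(\<Sum>v\<in>Pow ({1..d} - u). r ^ card v * (\<gamma> (u \<union> v) / \<gamma> u)) = row u r"
proof -
  have "row u r = (\<Sum>w\<in>{w. u \<subseteq> w \<and> w \<subseteq> {1..d}}. r ^ card (w - u) * (\<gamma> w / \<gamma> u))"
    unfolding row_def
  proof (rule sum.mono_neutral_left)
    show "finite {w. u \<subseteq> w \<and> w \<subseteq> {1..d}}"
      by (rule finite_subset[of _ "Pow {1..d}"]) auto
  qed (use S_subset \<gamma>_zero in auto)
  also have "\<dots> = (\<Sum>v\<in>Pow ({1..d} - u). r ^ card v * (\<gamma> (u \<union> v) / \<gamma> u))"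
    by (rule sum.reindex_bij_witness[of _ "\<lambda>v. u \<union> v" "\<lambda>w. w - u"])
      (use u in \<open>auto simp: Un_absorb1 intro!: arg_cong[where f = card]\<close>)
  finally show ?thesis ..
qed

lemma col_eq:
  assumes w: "w \<subseteq> {1..d}"
  shows "(\<Sum>u\<in>Pow w. r ^ (card w - card u) * (\<gamma> w / \<gamma> u)) = col w r"
  unfolding col_def
proof (rule sum.cong[OF refl])
  fix u assume "u \<in> Pow w"
  then have "card (w - u) = card w - card u"
    using w by (intro card_Diff_subset) (auto intro: finite_subset)
  then show "r ^ (card w - card u) * (\<gamma> w / \<gamma> u) = r ^ card (w - u) * (\<gamma> w / \<gamma> u)"
    by simp
qed

lemma c_eq: "c = (if p = \<infinity> then m_psi D \<psi> else kappa_psi D \<psi>)"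
  by (simp add: c_def m_psi_def kappa_psi_def)

lemma C_const_eq:
  assumes "q = 1 \<or> q = \<infinity>"
  shows "C_const d D \<psi> p q \<gamma> = (MAX u\<in>Pow {1..d}. entry_sum q u c)"
proof -
  have "(MAX u\<in>Pow {1..d}. \<Sum>v\<in>Pow ({1..d} - u). r ^ card v * (\<gamma> (u \<union> v) / \<gamma> u)) = (MAX u\<in>Pow {1..d}. row u r)"
    "(MAX v\<in>Pow {1..d}. \<Sum>u\<in>Pow v. r ^ (card v - card u) * (\<gamma> v / \<gamma> u)) = (MAX u\<in>Pow {1..d}. col u r)" for r
    by (intro arg_cong[where f = Max] image_cong refl row_eq col_eq; simp)+
  then show ?thesis
    using assms p_cases by (auto simp: C_const_def entry_sum_def c_eq)
qed

text \<open>A row vanishes because division by \<gamma> u = 0 gives 0, a column because its common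
  numerator is 0. This is where the convention 0 / 0 = 0 acts.\<close>

lemma entry_sum_zero: "u \<subseteq> {1..d} \<Longrightarrow> u \<notin> S \<Longrightarrow> entry_sum q u r = 0"
  by (simp add: entry_sum_def row_def col_def \<gamma>_zero)

lemma entry_sum_nonneg: "u \<subseteq> {1..d} \<Longrightarrow> 0 \<le> r \<Longrightarrow> 0 \<le> entry_sum q u r"
  unfolding entry_sum_def row_def col_def
  by (auto intro!: sum_nonneg mult_nonneg_nonneg divide_nonneg_nonneg \<gamma>_nonneg dest: S_subset)

lemma entry_sum_tendsto:
  assumes "r \<longlonglongrightarrow> a"
  shows "(\<lambda>n. entry_sum q u (r n)) \<longlonglongrightarrow> entry_sum q u a"
proof (cases "q = \<infinity>")
  case True
  show ?thesis
    unfolding entry_sum_def if_P[OF True] row_def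
    by (intro tendsto_sum tendsto_mult_right tendsto_power assms)
next
  case False
  show ?thesis
    unfolding entry_sum_def if_not_P[OF False] col_def
    by (intro tendsto_sum tendsto_mult_right tendsto_power assms)
qed

lemma C_const_upper:
  assumes "q = 1 \<or> q = \<infinity>" "u \<in> S"
  shows "entry_sum q u c \<le> C_const d D \<psi> p q \<gamma>"
  unfolding C_const_eq[OF assms(1)] using S_subset[OF assms(2)] by (intro Max_ge) auto

text \<open>The maximum ranges over all subsets of {1..d}, but lower bounds come only from index
  sets in \<open>S\<close>. If it is attained outside \<open>S\<close>, it equals 0 and is attained
  at the empty set as well.\<close>

lemma C_const_attained:
  assumes "q = 1 \<or> q = \<infinity>"
  obtains u where "u \<in> S" "C_const d D \<psi> p q \<gamma> = entry_sum q u c"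
proof -
  have "C_const d D \<psi> p q \<gamma> \<in> (\<lambda>u. entry_sum q u c) ` Pow {1..d}"
    unfolding C_const_eq[OF assms] by (intro Max_in) auto
  then obtain u where u: "u \<subseteq> {1..d}" "C_const d D \<psi> p q \<gamma> = entry_sum q u c" by auto
  show thesis
  proof (cases "u \<in> S")
    case False
    then have "entry_sum q {} c \<le> 0"
      using u C_const_upper[OF assms empty_in_S] entry_sum_zero by simp
    then have "entry_sum q {} c = 0"
      using entry_sum_nonneg[of "{}" c q] c_nonneg by simp
    then show thesis
      using that[OF empty_in_S] u False entry_sum_zero by simp
  qed (use that u in blast)
qed

section \<open>Upper bound by row and column sums\<close>

lemma lq_norm_change_le:
  assumes q: "q = 1 \<or> q = \<infinity>" and g: "\<And>w. w \<in> S \<Longrightarrow> g w \<in> L w"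
    and le: "lq_norm q S (\<lambda>u. N u (g u) / \<gamma> u) \<le> 1"
  shows "lq_norm q S (\<lambda>u. N u (change k g u) / \<gamma> u) \<le> C_const d D \<psi> p q \<gamma>"
proof -
  define a where "a u = N u (g u) / \<gamma> u" for u
  have a_nonneg: "0 \<le> a u" if "u \<in> S" for u
    using that N_nonneg[OF S_finite g] S_pos[of u] by (simp add: a_def)
  have N_nn: "0 \<le> N u (change k g u) / \<gamma> u" if "u \<in> S" for u
    using that N_nonneg[OF S_finite change_bound(1)[OF g]] S_pos[of u] by simp
  \<comment> \<open>Inserting \<gamma> w / \<gamma> w turns the norm estimate into the action of a
    nonnegative matrix on the vector \<open>a\<close> of weighted norms.\<close>
  have bound: "N u (change k g u) / \<gamma> u \<le> (\<Sum>w\<in>{w\<in>S. u \<subseteq> w}. c ^ card (w - u) * (\<gamma> w / \<gamma> u) * a w)"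
    if u: "u \<in> S" for u
  proof -
    have "N u (change k g u) / \<gamma> u \<le> (\<Sum>w\<in>{w\<in>S. u \<subseteq> w}. c ^ card (w - u) * N w (g w)) / \<gamma> u"
      using change_bound(2)[OF g u] S_pos[OF u] by (simp add: divide_right_mono)
    also have "\<dots> = (\<Sum>w\<in>{w\<in>S. u \<subseteq> w}. c ^ card (w - u) * (\<gamma> w / \<gamma> u) * a w)"
      unfolding sum_divide_distrib
    proof (rule sum.cong[OF refl])
      fix w assume "w \<in> {w\<in>S. u \<subseteq> w}"
      then show "c ^ card (w - u) * N w (g w) / \<gamma> u = c ^ card (w - u) * (\<gamma> w / \<gamma> u) * a w"
        using S_pos[of w] by (simp add: a_def)
    qed
    finally show ?thesis .
  qed
  have coeff: "0 \<le> c ^ card (w - u) * (\<gamma> w / \<gamma> u)" if "u \<in> S" "w \<in> S" for u w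
    using S_pos[OF that(1)] S_pos[OF that(2)] c_nonneg by simp
  show ?thesis
  proof (cases "q = \<infinity>")
    case True
    have a_le: "a w \<le> 1" if "w \<in> S" for w
    proof -
      have "\<bar>a w\<bar> \<le> Max ((\<lambda>u. \<bar>a u\<bar>) ` S)"
        using finite_S that by (intro Max_ge) auto
      then show ?thesis
        using le True unfolding lq_norm_def a_def[symmetric] by simp
    qed
    have "\<bar>N u (change k g u) / \<gamma> u\<bar> \<le> C_const d D \<psi> p q \<gamma>" if u: "u \<in> S" for u
    proof -
      have "(\<Sum>w\<in>{w\<in>S. u \<subseteq> w}. c ^ card (w - u) * (\<gamma> w / \<gamma> u) * a w) \<le> row u c"
        unfolding row_def using coeff[OF u] a_le by (intro sum_mono mult_left_le) auto
      also have "\<dots> \<le> C_const d D \<psi> p q \<gamma>"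
        using C_const_upper[OF q u] True by (simp add: entry_sum_def)
      finally show ?thesis
        using bound[OF u] N_nn[OF u] by linarith
    qed
    then show ?thesis
      using True finite_S empty_in_S by (auto simp: lq_norm_def intro!: Max.boundedI)
  next
    case False
    then have q1: "q = 1" using q by simp
    have sum_le: "(\<Sum>u\<in>S. a u) \<le> 1"
    proof -
      have "(\<Sum>u\<in>S. \<bar>a u\<bar>) \<le> 1"
        using le q1 by (simp add: lq_norm_def a_def sum_nonneg)
      then show ?thesis using a_nonneg by simp
    qed
    have Pow: "Pow w = {u\<in>S. u \<subseteq> w}" if "w \<in> S" for w
      using S_down[OF that] by auto
    have "(\<Sum>u\<in>S. \<bar>N u (change k g u) / \<gamma> u\<bar>) = (\<Sum>u\<in>S. N u (change k g u) / \<gamma> u)"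
      using N_nn by (intro sum.cong refl abs_of_nonneg)
    also have "\<dots> \<le> (\<Sum>u\<in>S. \<Sum>w\<in>{w\<in>S. u \<subseteq> w}. c ^ card (w - u) * (\<gamma> w / \<gamma> u) * a w)"
      by (intro sum_mono bound)
    \<comment> \<open>Interchanging the sums collects the factor of each \<open>a w\<close>, which
      is the column sum at \<open>w\<close>.\<close>
    also have "\<dots> = (\<Sum>w\<in>S. \<Sum>u\<in>{u\<in>S. u \<subseteq> w}. c ^ card (w - u) * (\<gamma> w / \<gamma> u) * a w)"
      by (rule sum.swap_restrict[OF finite_S finite_S])
    also have "\<dots> = (\<Sum>w\<in>S. col w c * a w)"
      by (intro sum.cong refl) (simp add: col_def Pow sum_distrib_right)
    also have "\<dots> \<le> (\<Sum>w\<in>S. C_const d D \<psi> p q \<gamma> * a w)"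
      using C_const_upper[OF q] False a_nonneg
      by (intro sum_mono mult_right_mono) (auto simp: entry_sum_def)
    also have "\<dots> = C_const d D \<psi> p q \<gamma> * (\<Sum>w\<in>S. a w)"
      by (simp add: sum_distrib_left)
    also have "\<dots> \<le> C_const d D \<psi> p q \<gamma>"
    proof (rule mult_left_le[OF sum_le])
      show "0 \<le> C_const d D \<psi> p q \<gamma>"
        using C_const_upper[OF q empty_in_S] entry_sum_nonneg[of "{}" c q] c_nonneg by simp
    qed
    finally show ?thesis
      using q1 by (simp add: lq_norm_def sum_nonneg)
  qed
qed

section \<open>Sharpness of the bound\<close>

lemma change_test:
  assumes "test \<phi>" "u \<in> S"
  shows "change k (\<lambda>w t. r w * (\<Prod>j\<in>w. \<phi> (t j))) u
    = (\<lambda>t. (\<Sum>w\<in>{w\<in>S. u \<subseteq> w}. sgn_kind k ^ card (w - u) * r w * (LINT s|lebesgue_on D. \<phi> s * b s) ^ card (w - u))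
        * (\<Prod>j\<in>u. \<phi> (t j)))"
proof (rule ext)
  fix t
  have "P w u (\<lambda>t. r w * (\<Prod>j\<in>w. \<phi> (t j))) t
      = r w * ((LINT s|lebesgue_on D. \<phi> s * b s) ^ card (w - u) * (\<Prod>j\<in>u. \<phi> (t j)))"
    if "w \<in> {w\<in>S. u \<subseteq> w}" for w
  proof -
    have "P w u (\<lambda>t. r w * (\<Prod>j\<in>w. \<phi> (t j))) t = r w * P w u (\<lambda>t. \<Prod>j\<in>w. \<phi> (t j)) t"
      by (simp add: P_def mult.assoc)
    then show ?thesis
      using that P_test[OF S_finite _ assms(1)] by simp
  qed
  then show "change k (\<lambda>w t. r w * (\<Prod>j\<in>w. \<phi> (t j))) u t
    = (\<Sum>w\<in>{w\<in>S. u \<subseteq> w}. sgn_kind k ^ card (w - u) * r w * (LINT s|lebesgue_on D. \<phi> s * b s) ^ card (w - u))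
        * (\<Prod>j\<in>u. \<phi> (t j))"
    unfolding change_def sum_distrib_right by (intro sum.cong refl) (simp add: mult_ac)
qed

text \<open>On multiples of tensor powers of one \<phi> the change of components acts as a signed
  scalar matrix. For q = \<infinity> every component has weighted norm 1, with signs that make all
  terms of row \<open>s\<close> add up; for q = 1 only component \<open>s\<close> is nonzero and the
  whole column \<open>s\<close> is seen.\<close>

lemma test_lower:
  assumes q: "q = 1 \<or> q = \<infinity>" and \<phi>: "test \<phi>" and s: "s \<in> S"
    and r: "r = (LINT t|lebesgue_on D. \<phi> t * b t)"
  shows "\<exists>g. (\<forall>w\<in>S. g w \<in> L w) \<and> lq_norm q S (\<lambda>u. N u (g u) / \<gamma> u) \<le> 1
    \<and> entry_sum q s r \<le> lq_norm q S (\<lambda>u. N u (change k g u) / \<gamma> u)"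
proof -
  have r_nonneg: "0 \<le> r"
    unfolding r using \<phi> psibar_nonneg
    by (intro integral_nonneg_AE AE_I2) (auto simp: test_def)
  have test_u: "(\<lambda>t. a * (\<Prod>j\<in>u. \<phi> (t j))) \<in> L u" "N u (\<lambda>t. a * (\<Prod>j\<in>u. \<phi> (t j))) = \<bar>a\<bar>"
    if "u \<in> S" for u a
    using test_norm[OF S_finite[OF that] \<phi>] L_scale[OF S_finite[OF that]] by auto
  show ?thesis
  proof (cases "q = \<infinity>")
    case True
    define g where "g w t = sgn_kind k ^ card w * \<gamma> w * (\<Prod>j\<in>w. \<phi> (t j))" for w t
    have g: "g w \<in> L w" "N w (g w) = \<gamma> w" if "w \<in> S" for w
      unfolding g_def[abs_def] using test_u[OF that] S_pos[OF that] by (simp_all add: abs_mult)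
    have "lq_norm q S (\<lambda>u. N u (g u) / \<gamma> u) \<le> 1"
      using True finite_S empty_in_S S_pos g by (auto simp: lq_norm_def intro!: Max.boundedI)
    moreover have "N s (change k g s) / \<gamma> s = row s r"
    proof -
      let ?V = "{w\<in>S. s \<subseteq> w}"
      \<comment> \<open>The sign produced by the change times the sign put into component
        \<open>w\<close> depends only on \<open>s\<close>, so nothing cancels.\<close>
      have sg: "sgn_kind k ^ card (w - s) * sgn_kind k ^ card w = sgn_kind k ^ card s" if "w \<in> ?V" for w
      proof -
        have "card w = card (w - s) + card s"
          using that S_finite[of w] S_finite[OF s] by (simp add: card_Diff_subset card_mono)
        then show ?thesis
          using sgn_kind_sq[of k "card (w - s)"] by (simp add: power_add flip: mult.assoc)
      qed
      have "(\<Sum>w\<in>?V. sgn_kind k ^ card (w - s) * (sgn_kind k ^ card w * \<gamma> w) * r ^ card (w - s))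
          = sgn_kind k ^ card s * (\<Sum>w\<in>?V. r ^ card (w - s) * \<gamma> w)"
        unfolding sum_distrib_left
      proof (rule sum.cong[OF refl])
        fix w assume "w \<in> ?V"
        from sg[OF this] show "sgn_kind k ^ card (w - s) * (sgn_kind k ^ card w * \<gamma> w) * r ^ card (w - s)
            = sgn_kind k ^ card s * (r ^ card (w - s) * \<gamma> w)"
          by (simp flip: mult.assoc)
      qed
      then have "N s (change k g s) = \<bar>sgn_kind k ^ card s * (\<Sum>w\<in>?V. r ^ card (w - s) * \<gamma> w)\<bar>"
        unfolding g_def[abs_def] change_test[OF \<phi> s] using test_u[OF s] r by simp
      also have "\<dots> = (\<Sum>w\<in>?V. r ^ card (w - s) * \<gamma> w)"
      proof -
        have "0 \<le> (\<Sum>w\<in>?V. r ^ card (w - s) * \<gamma> w)"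
          using r_nonneg S_pos by (intro sum_nonneg mult_nonneg_nonneg) (auto intro: less_imp_le)
        then show ?thesis
          by (simp add: abs_mult)
      qed
      finally show ?thesis
        by (simp add: row_def sum_divide_distrib)
    qed
    moreover have "\<bar>N s (change k g s) / \<gamma> s\<bar> \<le> lq_norm q S (\<lambda>u. N u (change k g u) / \<gamma> u)"
      using True finite_S s by (auto simp: lq_norm_def intro!: Max_ge)
    ultimately show ?thesis
      using g(1) True by (intro exI[of _ g]) (auto simp: entry_sum_def)
  next
    case False
    then have q1: "q = 1" using q by simp
    define g where "g w t = (if w = s then \<gamma> s else 0) * (\<Prod>j\<in>w. \<phi> (t j))" for w t
    have g: "g w \<in> L w" "N w (g w) = (if w = s then \<gamma> s else 0)" if "w \<in> S" for w
      unfolding g_def[abs_def] using test_u[OF that] S_pos[OF s] by (auto simp del: mult_eq_0_iff)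
    have "(\<Sum>u\<in>S. \<bar>N u (g u) / \<gamma> u\<bar>) = (\<Sum>u\<in>S. if u = s then 1 else 0)"
      using g(2) S_pos by (intro sum.cong refl) (auto simp: less_imp_neq[THEN not_sym])
    then have "lq_norm q S (\<lambda>u. N u (g u) / \<gamma> u) \<le> 1"
      using q1 finite_S s by (simp add: lq_norm_def)
    moreover have eq: "N u (change k g u) / \<gamma> u = r ^ card (s - u) * (\<gamma> s / \<gamma> u)" if u: "u \<in> Pow s" for u
    proof -
      have uS: "u \<in> S" using S_down[OF s] u by auto
      have "(\<Sum>w\<in>{w\<in>S. u \<subseteq> w}. sgn_kind k ^ card (w - u) * (if w = s then \<gamma> s else 0) * r ^ card (w - u))
          = (\<Sum>w\<in>{w\<in>S. u \<subseteq> w}. if w = s then sgn_kind k ^ card (s - u) * \<gamma> s * r ^ card (s - u) else 0)"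
        by (intro sum.cong) auto
      also have "\<dots> = sgn_kind k ^ card (s - u) * \<gamma> s * r ^ card (s - u)"
        using finite_S s u by (subst sum.delta) auto
      finally have "N u (change k g u) = \<bar>sgn_kind k ^ card (s - u) * \<gamma> s * r ^ card (s - u)\<bar>"
        unfolding g_def[abs_def] change_test[OF \<phi> uS] using test_u[OF uS] r by simp
      then show ?thesis
        using r_nonneg S_pos[OF s] by (simp add: abs_mult)
    qed
    have "col s r = (\<Sum>u\<in>Pow s. \<bar>N u (change k g u) / \<gamma> u\<bar>)"
      unfolding col_def
    proof (intro sum.cong refl)
      fix u assume u: "u \<in> Pow s"
      then have "0 < \<gamma> u" using S_pos[OF S_down[OF s]] by simp
      then have "0 \<le> r ^ card (s - u) * (\<gamma> s / \<gamma> u)"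
        using r_nonneg S_pos[OF s] by simp
      then show "r ^ card (s - u) * (\<gamma> s / \<gamma> u) = \<bar>N u (change k g u) / \<gamma> u\<bar>"
        unfolding eq[OF u] by (rule abs_of_nonneg[symmetric])
    qed
    moreover have "\<dots> \<le> (\<Sum>u\<in>S. \<bar>N u (change k g u) / \<gamma> u\<bar>)"
      using finite_S S_down[OF s] by (intro sum_mono2) auto
    ultimately show ?thesis
      using g(1) q1 by (intro exI[of _ g]) (auto simp: entry_sum_def lq_norm_def sum_nonneg)
  qed
qed

text \<open>The kind ANOVA gives the embedding and the kind Anchored its inverse. The map is assumed
  to act identically on the space only, since \<open>iota\<close> and its
  \<open>the_inv_into\<close> are unspecified elsewhere.\<close>

lemma op_norm_eq:
  assumes q: "q = 1 \<or> q = \<infinity>"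
    and id: "\<And>f. f \<in> W_space k d D \<psi> p \<gamma> \<Longrightarrow> \<phi> f = f"
  shows "op_norm (W_space k d D \<psi> p \<gamma>) (W_norm k d D \<psi> p q \<gamma>) (W_norm (dual k) d D \<psi> p q \<gamma>) \<phi>
    = ereal (C_const d D \<psi> p q \<gamma>)" (is "?op = _")
proof (rule antisym)
  show "?op \<le> ereal (C_const d D \<psi> p q \<gamma>)"
    unfolding op_norm_def
  proof (rule SUP_least)
    fix f assume f: "f \<in> {f \<in> W_space k d D \<psi> p \<gamma>. W_norm k d D \<psi> p q \<gamma> f \<le> 1}"
    then obtain g where g: "rep k g f"
      by (auto simp: W_space_def)
    have "lq_norm q S (\<lambda>u. N u (g u) / \<gamma> u) \<le> 1"
      using f W_norm_eq[OF g] by simp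
    then have "lq_norm q S (\<lambda>u. N u (change k g u) / \<gamma> u) \<le> C_const d D \<psi> p q \<gamma>"
      by (intro lq_norm_change_le q rep_L[OF g])
    then show "ereal (W_norm (dual k) d D \<psi> p q \<gamma> (\<phi> f)) \<le> ereal (C_const d D \<psi> p q \<gamma>)"
      using f id W_norm_eq[OF rep_change[OF g]] by simp
  qed
  obtain s where s: "s \<in> S" "C_const d D \<psi> p q \<gamma> = entry_sum q s c"
    using C_const_attained[OF q] .
  have lower: "ereal (entry_sum q s (LINT t|lebesgue_on D. \<theta> t * b t)) \<le> ?op" if \<theta>: "test \<theta>" for \<theta>
  proof -
    obtain g where g: "\<forall>w\<in>S. g w \<in> L w" "lq_norm q S (\<lambda>u. N u (g u) / \<gamma> u) \<le> 1"
      "entry_sum q s (LINT t|lebesgue_on D. \<theta> t * b t) \<le> lq_norm q S (\<lambda>u. N u (change k g u) / \<gamma> u)"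
      using test_lower[OF q \<theta> s(1) refl] by blast
    define f where "f = (\<lambda>x\<in>Dd. \<Sum>u\<in>S. T k u (g u) x)"
    have f: "rep k g f"
      using g(1) by (intro repI) (auto simp: f_def)
    then have f_in: "f \<in> {f \<in> W_space k d D \<psi> p \<gamma>. W_norm k d D \<psi> p q \<gamma> f \<le> 1}"
      using g(2) W_norm_eq[OF f] by (auto simp: W_space_def)
    have "ereal (entry_sum q s (LINT t|lebesgue_on D. \<theta> t * b t)) \<le> ereal (W_norm (dual k) d D \<psi> p q \<gamma> (\<phi> f))"
      using g(3) f_in id W_norm_eq[OF rep_change[OF f]] by simp
    also have "\<dots> \<le> ?op"
      unfolding op_norm_def by (rule SUP_upper[OF f_in])
    finally show ?thesis .
  qed
  \<comment> \<open>Each test function gives a lower bound with its own value in place of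
    \<open>c\<close>. These values converge to \<open>c\<close>, and the row or column sum is a
    polynomial in the value, so the bound passes to the limit.\<close>
  have "\<forall>n. \<exists>\<theta>. test \<theta> \<and> c - 1 / real (Suc n) \<le> (LINT t|lebesgue_on D. \<theta> t * b t)
      \<and> (LINT t|lebesgue_on D. \<theta> t * b t) \<le> c"
    using test_approx by simp
  from choice[OF this] obtain \<theta> where \<theta>: "\<And>n. test (\<theta> n)"
    "\<And>n. c - 1 / real (Suc n) \<le> (LINT t|lebesgue_on D. \<theta> n t * b t)"
    "\<And>n. (LINT t|lebesgue_on D. \<theta> n t * b t) \<le> c"
    by blast
  define r where "r n = (LINT t|lebesgue_on D. \<theta> n t * b t)" for n
  have "(\<lambda>n. c - 1 / real (Suc n)) \<longlonglongrightarrow> c - 0"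
    by (intro tendsto_intros LIMSEQ_Suc[OF lim_1_over_n])
  then have "r \<longlonglongrightarrow> c"
    by (intro tendsto_sandwich[of "\<lambda>n. c - 1 / real (Suc n)" r _ "\<lambda>_. c"])
      (use \<theta> in \<open>auto simp: r_def\<close>)
  then have "(\<lambda>n. entry_sum q s (r n)) \<longlonglongrightarrow> entry_sum q s c"
    by (rule entry_sum_tendsto)
  then have "(\<lambda>n. ereal (entry_sum q s (r n))) \<longlonglongrightarrow> ereal (entry_sum q s c)"
    by simp
  then show "ereal (C_const d D \<psi> p q \<gamma>) \<le> ?op"
    unfolding s(2) by (rule LIMSEQ_le_const2) (use lower[OF \<theta>(1)] in \<open>auto simp: r_def\<close>)
qed

end

section \<open>The embedding and its inverse\<close>

theorem theorem15:
  fixes d :: nat and D :: "real set" and \<psi> :: "real \<Rightarrow> real"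
    and \<gamma> :: "nat set \<Rightarrow> real" and p q :: ereal
  assumes "1 \<le> d"
    and "is_domain D"
    and "is_pos_density D \<psi>"
    and "p \<in> {1, \<infinity>}" and "q \<in> {1, \<infinity>}"
    and "integrability_cond p D \<psi>"
    and "\<forall>u \<subseteq> {1..d}. 0 \<le> \<gamma> u"
    and "\<exists>u \<subseteq> {1..d}. \<gamma> u \<noteq> 0"
    and "\<forall>w \<subseteq> {1..d}. 0 < \<gamma> w \<longrightarrow> (\<forall>u \<subseteq> w. 0 < \<gamma> u)"
  shows "bij_betw (iota d D \<psi> p \<gamma>) (W_space ANOVA d D \<psi> p \<gamma>) (W_space Anchored d D \<psi> p \<gamma>)
    \<and> op_norm (W_space ANOVA d D \<psi> p \<gamma>)
        (W_norm ANOVA d D \<psi> p q \<gamma>) (W_norm Anchored d D \<psi> p q \<gamma>)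
        (iota d D \<psi> p \<gamma>) = ereal (C_const d D \<psi> p q \<gamma>)
    \<and> op_norm (W_space Anchored d D \<psi> p \<gamma>)
        (W_norm Anchored d D \<psi> p q \<gamma>) (W_norm ANOVA d D \<psi> p q \<gamma>)
        (the_inv_into (W_space ANOVA d D \<psi> p \<gamma>) (iota d D \<psi> p \<gamma>)) = ereal (C_const d D \<psi> p q \<gamma>)"
proof -
  interpret anova_setting D \<psi> p d \<gamma>
    using assms by unfold_locales auto
  let ?W = "W_space ANOVA d D \<psi> p \<gamma>"
  have q: "q = 1 \<or> q = \<infinity>"
    using assms(5) by auto
  have iota: "iota d D \<psi> p \<gamma> f = f" if "f \<in> ?W" for f
    using that by (simp add: iota_def)
  have bij: "bij_betw (iota d D \<psi> p \<gamma>) ?W (W_space Anchored d D \<psi> p \<gamma>)"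
    using iota by (subst W_space_eq[symmetric], subst bij_betw_cong[of _ _ id]) auto
  have inv: "the_inv_into ?W (iota d D \<psi> p \<gamma>) f = f" if "f \<in> W_space Anchored d D \<psi> p \<gamma>" for f
  proof (rule the_inv_into_f_eq)
    show "inj_on (iota d D \<psi> p \<gamma>) ?W"
      using bij by (rule bij_betw_imp_inj_on)
  qed (use that iota in \<open>simp_all add: W_space_eq\<close>)
  show ?thesis
    using bij op_norm_eq[OF q, of ANOVA, OF iota] op_norm_eq[OF q, of Anchored, OF inv] by simp
qed

end
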